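(* Let $n\ge 1$ and let $T,S\in\mathbf{T}_n^2$ be standard Young tableaux with at most two columns. Then $T<_C S$ (in the chain order on tableaux) if and only if $w_T<_D w_S$ (in the right weak order on words).
   Context: A (Young) tableau with entry set $E=\{m_1<\dots<m_n\}\subset\mathbb{Z}_{>0}$ is a filling of a Young diagram with $n$ boxes by the elements of $E$, each used once, increasing along rows (left to right) and down columns. It is standard if $E=\{1,\dots,n\}$. $\mathbf{T}_n^2$ is the set of standard tableaux with $n$ boxes and at most two columns, written $T=(T_1,T_2)$ with $T_i$ the $i$-th column ($T_2$ may be empty). Shapes: $\mathrm{sh}(T)=(\lambda_1\ge\lambda_2\ge\dots)$ is the list of column lengths. Dominance order: $\lambda\ge\mu$ iff $\sum_{m\le i}\lambda_m\ge\sum_{m\le i}\mu_m$ for all $i$ not exceeding the number of parts of either. Projections: for $1\le i<j\le n$, $\pi_{i,j}(T)$ is obtained from $T$ by removing the entries $m_1,\dots,m_{i-1},m_{j+1},\dots,m_n$ by jeu de taquin (to remove an entry, delete it, repeatedly slide into the hole the smaller of the entries immediately to its right and immediately below it, until the hole is at an outer corner, then discard the hole; the final result does not depend on the order of removals). Chain order: for tableaux with the same entry set of size $n$, $T\le_C S$ iff $\mathrm{sh}(\pi_{i,j}(T))\le\mathrm{sh}(\pi_{i,j}(S))$ for all $1\le i<j\le n$; $T<_C S$ means $T\le_C S$ and $T\ne S$. Right weak order: for words $w=[a_1,\dots,a_n]$ and $y$ which are arrangements of $\{1,\dots,n\}$, let $p_w(i)$ be the position of the letter $i$ in $w$. Put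 $w\le_D y$ iff for all $i<j$, $p_w(j)<p_w(i)$ implies $p_y(j)<p_y(i)$; $w<_D y$ means moreover $w\ne y$. Deletion: let $T$ be a tableau with at most two columns and let $a$ be an entry of $T$ at a corner box $c$ (no neighbours to the right or below). If $a$ is in the first column, $T\Leftarrow a$ is $T$ with that box removed, and $a^T:=a$. If $a$ is in the second column, $T\Leftarrow a$ is obtained by deleting $a$ from the second column and replacing by $a$ the greatest entry $b$ of the first column with $b<a$; then $a^T:=b$. The word $w_T$: for $T\in\mathbf{T}_n^2$ put $T_{(n)}=T$ and, for $i=n,n-1,\dots,1$, let $z_i$ be the maximal entry of $T_{(i)}$ (a corner entry), $a_i:=z_i^{T_{(i)}}$ and $T_{(i-1)}:=T_{(i)}\Leftarrow z_i$. Then $w_T:=[a_n,a_{n-1},\dots,a_1]$. *)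

theory Defs
  imports "HOL-Combinatorics.Multiset_Permutations"
begin

text \<open>
  A box is a pair (row, column), both counted from 0, and a filling is a finite partial map from
  boxes to entries. Column 0 is the first column, and rows are numbered downwards.
\<close>

type_synonym tableau = "nat \<times> nat \<rightharpoonup> nat"

definition young_diagram :: "(nat \<times> nat) set \<Rightarrow> bool" where
  "young_diagram D \<longleftrightarrow>
     finite D \<and> (\<forall>r c r' c'. (r, c) \<in> D \<and> r' \<le> r \<and> c' \<le> c \<longrightarrow> (r', c') \<in> D)"

definition young_tableau :: "nat set \<Rightarrow> tableau \<Rightarrow> bool" where
  "young_tableau E T \<longleftrightarrow>
     0 \<notin> E \<and> young_diagram (dom T) \<and> inj_on T (dom T) \<and> ran T = E \<and>
     (\<forall>r c x y. T (r, c) = Some x \<and> T (r, Suc c) = Some y \<longrightarrow> x < y) \<and>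
     (\<forall>r c x y. T (r, c) = Some x \<and> T (Suc r, c) = Some y \<longrightarrow> x < y)"

definition standard_tableau :: "nat \<Rightarrow> tableau \<Rightarrow> bool" where
  "standard_tableau n T \<longleftrightarrow> young_tableau {1..n} T"

definition two_column_tableaux :: "nat \<Rightarrow> tableau set" where
  "two_column_tableaux n = {T. standard_tableau n T \<and> (\<forall>(r, c) \<in> dom T. c < 2)}"

definition column_length :: "tableau \<Rightarrow> nat \<Rightarrow> nat" where
  "column_length T c = card {r. (r, c) \<in> dom T}"

definition shape :: "tableau \<Rightarrow> nat list" where
  "shape T = map (column_length T) [0..<card {c. (0, c) \<in> dom T}]"

definition dominance_le :: "nat list \<Rightarrow> nat list \<Rightarrow> bool" where
  "dominance_le m l \<longleftrightarrow>
     (\<forall>i. i \<le> length l \<and> i \<le> length m \<longrightarrow> sum_list (take i m) \<le> sum_list (take i l))"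

definition box_of :: "tableau \<Rightarrow> nat \<Rightarrow> nat \<times> nat" where
  "box_of T a = (THE b. T b = Some a)"

text \<open>
  The box from which an entry slides into a hole at (r, c): the right or the lower neighbour,
  whichever holds the smaller entry, and None at an outer corner.
\<close>

definition slide_source :: "tableau \<Rightarrow> nat \<times> nat \<Rightarrow> (nat \<times> nat) option" where
  "slide_source T h = (let right = (fst h, Suc (snd h)); below = (Suc (fst h), snd h) in
     case T right of
       None \<Rightarrow> (case T below of None \<Rightarrow> None | Some y \<Rightarrow> Some below)
     | Some x \<Rightarrow> (case T below of None \<Rightarrow> Some right
                               | Some y \<Rightarrow> Some (if x < y then right else below)))"

text \<open>
  The second argument of slide is the hole. The box of the hole keeps a stale entry until it is
  filled or discarded; this entry is never read. The recursion ends for every T with finite domain.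
\<close>

partial_function (tailrec) slide :: "tableau \<Rightarrow> nat \<times> nat \<Rightarrow> tableau" where
  "slide T h =
     (case slide_source T h of
        None \<Rightarrow> T(h := None)
      | Some h' \<Rightarrow> slide (T(h := T h')) h')"

definition jdt_remove :: "nat \<Rightarrow> tableau \<Rightarrow> tableau" where
  "jdt_remove a T = slide T (box_of T a)"

text \<open>
  The indices i and j are positions (from 1) in the increasing list of entries. The result does not
  depend on the order of the removals; here they are made in increasing order of the entries.
\<close>

definition projection :: "nat \<Rightarrow> nat \<Rightarrow> tableau \<Rightarrow> tableau" where
  "projection i j T =
     (let ms = sorted_list_of_set (ran T) in fold jdt_remove (take (i - 1) ms @ drop j ms) T)"

definition chain_le :: "tableau \<Rightarrow> tableau \<Rightarrow> bool" where
  "chain_le T S \<longleftrightarrow> ran T = ran S \<and>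
     (\<forall>i j. 1 \<le> i \<and> i < j \<and> j \<le> card (ran T) \<longrightarrow>
        dominance_le (shape (projection i j T)) (shape (projection i j S)))"

definition chain_less :: "tableau \<Rightarrow> tableau \<Rightarrow> bool" where
  "chain_less T S \<longleftrightarrow> chain_le T S \<and> T \<noteq> S"

definition position :: "nat list \<Rightarrow> nat \<Rightarrow> nat" where
  "position w i = (THE k. k < length w \<and> w ! k = i)"

definition right_weak_le :: "nat \<Rightarrow> nat list \<Rightarrow> nat list \<Rightarrow> bool" where
  "right_weak_le n w y \<longleftrightarrow>
     w \<in> permutations_of_set {1..n} \<and> y \<in> permutations_of_set {1..n} \<and>
     (\<forall>i j. 1 \<le> i \<and> i < j \<and> j \<le> n \<longrightarrow>
        position w j < position w i \<longrightarrow> position y j < position y i)"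

definition right_weak_less :: "nat \<Rightarrow> nat list \<Rightarrow> nat list \<Rightarrow> bool" where
  "right_weak_less n w y \<longleftrightarrow> right_weak_le n w y \<and> w \<noteq> y"

text \<open>
  Deletion of a corner entry a from a tableau with at most two columns: the tableau
  \<open>T \<Leftarrow> a\<close> is delete_corner T a, and the number \<open>a\<^sup>T\<close> is
  expelled T a. Both are meaningful only if a is such an entry.
\<close>

definition expelled :: "tableau \<Rightarrow> nat \<Rightarrow> nat" where
  "expelled T a =
     (if snd (box_of T a) = 0 then a else Max {b. b < a \<and> (\<exists>r. T (r, 0) = Some b)})"

definition delete_corner :: "tableau \<Rightarrow> nat \<Rightarrow> tableau" where
  "delete_corner T a =
     (if snd (box_of T a) = 0 then T(box_of T a := None)
      else T(box_of T a := None, box_of T (expelled T a) := Some a))"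

text \<open>
  The list word_aux i U, for U with i boxes, is \<open>[a\<^sub>i, \<dots>, a\<^sub>1]\<close>.
\<close>

fun word_aux :: "nat \<Rightarrow> tableau \<Rightarrow> nat list" where
  "word_aux 0 U = []"
| "word_aux (Suc i) U =
     (let z = Max (ran U) in expelled U z # word_aux i (delete_corner U z))"

definition tableau_word :: "tableau \<Rightarrow> nat list" where
  "tableau_word T = word_aux (card (dom T)) T"

end

theory Submission
  imports Defs
begin

text \<open>
  Read the entries of a two-column tableau in increasing order, writing an opening bracket for an
  entry of the first column and a closing bracket for an entry of the second. Removing the least
  entry by jeu de taquin turns its matching closing bracket into an opening one, so the second
  column of \<open>\<pi>\<^sub>i\<^sub>,\<^sub>j(T)\<close> has as many boxes as there are bracket pairs (arcs) inside
  \<open>[i, j]\<close>. Points below an arc are all matched, and comparing these numbers shows that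
  \<open>T \<le> S\<close> in the chain order iff every arc of S is an arc of T.

  On the side of words, b stands before c > b in \<open>w\<^sub>T\<close> iff b is in the first column, c is in the
  second column and, for some j \<open>\<ge>\<close> c, there are at most as many opening brackets in \<open>[b, j]\<close> as
  closing ones in \<open>[c, j]\<close> (an ascent). Inclusion of ascents and inclusion of arcs are equivalent,
  since each of them is determined by the columns of the entries that are matched in S.
\<close>

section \<open>Bracket matching\<close>

text \<open>Numbers of arcs suffice because an arc of S from b to k tiles its interval: every point
  of [b, k] is an endpoint of an arc inside, and no filling can have more arcs there. If T has at
  least as many, [b, k] is tiled in T too, so b opens and k closes in T as well. The inclusions run
  from S to T since the dominant shape has the shorter second column, and since ascents are the
  non-inversions of the word. Origin of the ascent condition: a greatest entry z that closes expels
  the greatest opening bracket left, takes its place, and is itself the next letter. So the closing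
  brackets, taken from the right, consume opening brackets greedily, and b is gone by the time c is
  expelled iff, for some j, those in [c, j] use up all opening brackets of [b, j]. This pairing is
  not the one by arcs: in \<open>(())\<close> it joins 4 to 2 and 3 to 1. Hence arcs and ascents
  cannot be compared pair by pair, only through the columns of their endpoints.\<close>

definition height :: "nat set \<Rightarrow> nat set \<Rightarrow> nat \<Rightarrow> int" where
  "height X Y x = int (card (X \<inter> {..<x})) - int (card (Y \<inter> {..<x}))"

text \<open>Heights are read just before a position, so the step at \<open>k\<close> ends at
  \<open>Suc k\<close>: \<open>k\<close> is the step by which the path first returns to its level at
  \<open>a\<close>.\<close>

definition arc :: "nat set \<Rightarrow> nat set \<Rightarrow> nat \<Rightarrow> nat \<Rightarrow> bool" where
  "arc X Y a k \<longleftrightarrow> a < k \<and> height X Y (Suc k) = height X Y a \<and>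
     (\<forall>x. a < x \<and> x \<le> k \<longrightarrow> height X Y a < height X Y x)"

definition ascent :: "nat set \<Rightarrow> nat set \<Rightarrow> nat \<Rightarrow> nat \<Rightarrow> bool" where
  "ascent X Y b c \<longleftrightarrow> b \<in> X \<and> c \<in> Y \<and> b < c \<and>
     (\<exists>j\<ge>c. card (X \<inter> {b..j}) \<le> card (Y \<inter> {c..j}))"

lemma card_split:
  fixes X :: "nat set"
  assumes "a \<le> b"
  shows "card (X \<inter> {..<b}) = card (X \<inter> {..<a}) + card (X \<inter> {a..<b})"
proof -
  have "X \<inter> {..<b} = (X \<inter> {..<a}) \<union> (X \<inter> {a..<b})" using assms by auto
  moreover have "card ((X \<inter> {..<a}) \<union> (X \<inter> {a..<b})) = card (X \<inter> {..<a}) + card (X \<inter> {a..<b})"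
    by (rule card_Un_disjoint) auto
  ultimately show ?thesis by (rule ssubst)
qed

lemma card_Icc_split:
  fixes X :: "nat set"
  assumes "a \<le> b" "b \<le> Suc c"
  shows "card (X \<inter> {a..c}) = card (X \<inter> {a..<b}) + card (X \<inter> {b..c})"
proof -
  have "X \<inter> {a..c} = (X \<inter> {a..<b}) \<union> (X \<inter> {b..c})" using assms by auto
  moreover have "card ((X \<inter> {a..<b}) \<union> (X \<inter> {b..c})) = card (X \<inter> {a..<b}) + card (X \<inter> {b..c})"
    by (rule card_Un_disjoint) auto
  ultimately show ?thesis by (rule ssubst)
qed

lemma height_diff:
  assumes "a \<le> b"
  shows "height X Y b = height X Y a + int (card (X \<inter> {a..<b})) - int (card (Y \<inter> {a..<b}))"
  using card_split[OF assms, of X] card_split[OF assms, of Y] by (simp add: height_def)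

lemma height_Suc:
  "height X Y (Suc x) = height X Y x + (if x \<in> X then 1 else 0) - (if x \<in> Y then 1 else 0)"
  using height_diff[of x "Suc x" X Y] by simp

text \<open>Only differences of heights enter, and in these the brackets before \<open>a\<close>
  cancel.\<close>

lemma arc_cong:
  assumes "X \<inter> {a..k} = X' \<inter> {a..k}" "Y \<inter> {a..k} = Y' \<inter> {a..k}"
  shows "arc X Y a k \<longleftrightarrow> arc X' Y' a k"
proof (cases "a < k")
  case True
  have "height X Y x - height X Y a = height X' Y' x - height X' Y' a" if "a \<le> x" "x \<le> Suc k" for x
  proof -
    have "X \<inter> {a..<x} = X' \<inter> {a..<x}" "Y \<inter> {a..<x} = Y' \<inter> {a..<x}"
      using assms that by fastforce+
    then show ?thesis using height_diff[OF that(1), of X Y] height_diff[OF that(1), of X' Y'] by simp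
  qed
  note d = this
  have "height X Y (Suc k) = height X Y a \<longleftrightarrow> height X' Y' (Suc k) = height X' Y' a"
    using d[of "Suc k"] True by auto
  moreover have "height X Y a < height X Y x \<longleftrightarrow> height X' Y' a < height X' Y' x"
    if "a < x" "x \<le> k" for x using d[of x] that by auto
  ultimately show ?thesis by (auto simp: arc_def)
qed (simp add: arc_def)

lemma arcD:
  assumes "arc X Y a k" "X \<inter> Y = {}"
  shows "a < k" "a \<in> X" "a \<notin> Y" "k \<in> Y" "k \<notin> X"
proof -
  have *: "a < k" "height X Y (Suc k) = height X Y a"
    "height X Y a < height X Y (Suc a)" "height X Y a < height X Y k"
    using assms(1) by (auto simp: arc_def)
  show "a < k" "a \<in> X" "k \<in> Y" using * by (auto simp: height_Suc split: if_splits)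
  then show "a \<notin> Y" "k \<notin> X" using assms(2) by auto
qed

lemma arc_end: "arc X Y a k \<Longrightarrow> height X Y (Suc k) = height X Y a"
  and arc_above: "arc X Y a k \<Longrightarrow> a < x \<Longrightarrow> x \<le> k \<Longrightarrow> height X Y a < height X Y x"
  by (auto simp: arc_def)

lemma arc_close_unique:
  assumes "arc X Y a k" "arc X Y a k'"
  shows "k = k'"
proof (rule ccontr)
  assume "k \<noteq> k'"
  then have "Suc k \<le> k' \<or> Suc k' \<le> k" by auto
  moreover have "a < Suc k" "a < Suc k'" using assms by (auto simp: arc_def)
  ultimately show False
    using arc_above[OF assms(2), of "Suc k"] arc_above[OF assms(1), of "Suc k'"]
      arc_end[OF assms(1)] arc_end[OF assms(2)] by auto
qed

lemma arc_open_unique: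
  assumes "arc X Y a k" "arc X Y a' k"
  shows "a = a'"
proof (rule ccontr)
  assume "a \<noteq> a'"
  then have "a < a' \<or> a' < a" by auto
  moreover have "a < k" "a' < k" using assms by (auto simp: arc_def)
  ultimately show False
    using arc_above[OF assms(1), of a'] arc_above[OF assms(2), of a]
      arc_end[OF assms(1)] arc_end[OF assms(2)] by auto
qed

text \<open>Take the first position after \<open>x\<close> that is not higher than \<open>x\<close>.
  A step lowers the height by at most 1, so the level of \<open>x\<close> is met exactly, and the
  match is the step just before.\<close>

lemma open_matched:
  assumes "x \<in> X" "X \<inter> Y = {}" "x \<le> j" "height X Y (Suc j) \<le> height X Y x"
  obtains k where "k \<le> j" "arc X Y x k"
proof -
  define P where "P y \<longleftrightarrow> x < y \<and> height X Y y \<le> height X Y x" for y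
  define y where "y = (LEAST y. P y)"
  have "P (Suc j)" using assms by (auto simp: P_def)
  then have y: "P y" "y \<le> Suc j" and min: "\<And>z. P z \<Longrightarrow> y \<le> z"
    by (auto simp: y_def intro: LeastI Least_le)
  have "height X Y (Suc x) = height X Y x + 1"
    using assms(1,2) by (auto simp: height_Suc)
  then have "y \<noteq> Suc x" using y by (auto simp: P_def)
  then obtain k where k: "y = Suc k" "x < k" using y(1) unfolding P_def by (cases y) auto
  have low: "height X Y x < height X Y z" if "x < z" "z \<le> k" for z
    using min[of z] that k by (force simp: P_def)
  have "height X Y (Suc k) \<ge> height X Y k - 1" by (simp add: height_Suc)
  then have "height X Y (Suc k) = height X Y x" using low[of k] k y(1) by (simp add: P_def)
  then have "arc X Y x k" using low k by (auto simp: arc_def)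
  then show ?thesis using that k y by auto
qed

text \<open>Mirror image of \<open>open_matched\<close>: the match is the last position up to
  \<open>k\<close> that is not higher than the path after \<open>k\<close>.\<close>

lemma close_matched:
  assumes "k \<in> Y" "X \<inter> Y = {}" "m \<le> k" "height X Y m \<le> height X Y (Suc k)"
  obtains a where "m \<le> a" "arc X Y a k"
proof -
  define P where "P y \<longleftrightarrow> y \<le> k \<and> height X Y y \<le> height X Y (Suc k)" for y
  define a where "a = (GREATEST y. P y)"
  have "P m" using assms by (auto simp: P_def)
  moreover have bd: "\<And>y. P y \<Longrightarrow> y \<le> k" by (auto simp: P_def)
  ultimately have a: "P a" "m \<le> a" and max: "\<And>z. P z \<Longrightarrow> z \<le> a"
    unfolding a_def by (blast intro: GreatestI_nat Greatest_le_nat)+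
  have "height X Y (Suc k) = height X Y k - 1" using assms(1,2) by (auto simp: height_Suc)
  then have "a \<noteq> k" using a by (auto simp: P_def)
  then have "a < k" using a by (auto simp: P_def)
  have high: "height X Y (Suc k) < height X Y z" if "a < z" "z \<le> k" for z
    using max[of z] that by (force simp: P_def)
  have "height X Y (Suc a) \<le> height X Y a + 1" by (simp add: height_Suc)
  then have "height X Y a = height X Y (Suc k)"
    using high[of "Suc a"] \<open>a < k\<close> a(1) by (simp add: P_def)
  then have "arc X Y a k" using high \<open>a < k\<close> by (auto simp: arc_def)
  then show ?thesis using that a by auto
qed

lemma open_in_arc_matched:
  assumes "arc X Y a k" "X \<inter> Y = {}" "x \<in> X" "a \<le> x" "x \<le> k"
  obtains l where "l \<le> k" "arc X Y x l"
proof (rule open_matched[OF assms(3,2,5)])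
  show "height X Y (Suc k) \<le> height X Y x"
    using assms(1,4,5) by (cases "x = a") (auto simp: arc_def less_imp_le)
qed

lemma close_in_arc_matched:
  assumes "arc X Y a k" "X \<inter> Y = {}" "y \<in> Y" "a \<le> y" "y \<le> k"
  obtains b where "a \<le> b" "arc X Y b y"
proof (rule close_matched[OF assms(3,2,4)])
  have "y = k \<or> Suc y \<le> k" using assms(5) by auto
  then show "height X Y a \<le> height X Y (Suc y)"
    using assms(1,4,5) by (auto simp: arc_def less_imp_le)
qed

text \<open>The bracket words of two-column tableaux with entry set \<open>{m..n}\<close>.
  Nonnegative heights make every closing bracket matched; opening ones may stay free. The lower end
  varies because projections drop initial entries.\<close>

definition ballot :: "nat \<Rightarrow> nat \<Rightarrow> nat set \<Rightarrow> nat set \<Rightarrow> bool" where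
  "ballot m n X Y \<longleftrightarrow> X \<union> Y = {m..n} \<and> X \<inter> Y = {} \<and> (\<forall>x. 0 \<le> height X Y x)"

lemma ballot_close_matched:
  assumes "ballot m n X Y" "k \<in> Y"
  obtains a where "m \<le> a" "arc X Y a k"
proof (rule close_matched[of k Y X m])
  show "k \<in> Y" "X \<inter> Y = {}" "m \<le> k" using assms by (auto simp: ballot_def)
  have "X \<union> Y = {m..n}" using assms(1) by (simp add: ballot_def)
  moreover have "{m..n} \<inter> {..<m} = {}" by auto
  ultimately have "X \<inter> {..<m} = {}" "Y \<inter> {..<m} = {}" by blast+
  then show "height X Y m \<le> height X Y (Suc k)" using assms(1) by (simp add: ballot_def height_def)
qed (use that in blast)

section \<open>Comparison of two bracket words\<close>

lemma same_types:
  assumes "X \<inter> Y = {}" "X' \<inter> Y' = {}" "X \<union> Y = X' \<union> Y'"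
    and "X \<inter> I \<subseteq> X'" "Y \<inter> I \<subseteq> Y'"
  shows "X \<inter> I = X' \<inter> I" "Y \<inter> I = Y' \<inter> I"
  using assms by blast+

text \<open>All points below an arc are endpoints of arcs, so the arcs of the first filling survive as
  soon as their endpoints keep their columns.\<close>

lemma arcs_transfer:
  assumes "ballot m n X Y" "ballot m n X' Y'"
    and types: "\<And>b k. arc X Y b k \<Longrightarrow> b \<in> X' \<and> k \<in> Y'"
    and "arc X Y a k"
  shows "arc X' Y' a k"
proof -
  have d: "X \<inter> Y = {}" "X' \<inter> Y' = {}" "X \<union> Y = {m..n}" "X' \<union> Y' = {m..n}"
    using assms by (auto simp: ballot_def)
  have "x \<in> X'" if "x \<in> X" "a \<le> x" "x \<le> k" for x
    using open_in_arc_matched[OF assms(4) d(1) that] types by blast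
  moreover have "y \<in> Y'" if "y \<in> Y" "a \<le> y" "y \<le> k" for y
    using close_in_arc_matched[OF assms(4) d(1) that] types by blast
  ultimately have "X \<inter> {a..k} = X' \<inter> {a..k}" "Y \<inter> {a..k} = Y' \<inter> {a..k}"
    using same_types[OF d(1,2), of "{a..k}"] d(3,4) by (simp_all add: subset_iff)
  then show ?thesis using assms(4) arc_cong by blast
qed

text \<open>For the least witness \<open>j\<close>, every opening bracket in \<open>{b..j}\<close>
  is matched, and so is every closing bracket. Arcs survive, so these points keep their columns,
  both words agree on \<open>{b..j}\<close>, and \<open>j\<close> is a witness for the second word
  as well.\<close>

lemma ascents_mono_if_arcs_mono:
  assumes "ballot m n X Y" "ballot m n X' Y'"
    and arcs: "\<And>b k. arc X Y b k \<Longrightarrow> arc X' Y' b k"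
    and "ascent X Y b c"
  shows "ascent X' Y' b c"
proof -
  have d: "X \<inter> Y = {}" "X' \<inter> Y' = {}" "X \<union> Y = {m..n}" "X' \<union> Y' = {m..n}"
    using assms by (auto simp: ballot_def)
  have bc: "b \<in> X" "c \<in> Y" "b < c" using assms(4) by (auto simp: ascent_def)
  define P where "P j \<longleftrightarrow> c \<le> j \<and> card (X \<inter> {b..j}) \<le> card (Y \<inter> {c..j})" for j
  define j where "j = (LEAST j. P j)"
  have "\<exists>j. P j" using assms(4) by (auto simp: ascent_def P_def)
  then have j: "P j" and min: "\<And>i. P i \<Longrightarrow> j \<le> i"
    by (auto simp: j_def intro: LeastI_ex Least_le)
  have "x \<in> X'" if x: "x \<in> X" "b \<le> x" "x \<le> j" for x
  proof -
    have "card (X \<inter> {x..j}) \<le> card (Y \<inter> {x..j})"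
    proof (cases "x < c")
      case True
      have "card (X \<inter> {x..j}) \<le> card (X \<inter> {b..j})" "card (Y \<inter> {c..j}) \<le> card (Y \<inter> {x..j})"
        using x True by (auto intro!: card_mono)
      then show ?thesis using j by (simp add: P_def)
    next
      case False
      then have "c < x" using d bc x by (cases "x = c") auto
      then have e: "{b..x-1} = {b..<x}" "{c..x-1} = {c..<x}" by auto
      \<comment> \<open>As \<open>x - 1\<close> is no witness, \<open>{b..<x}\<close> holds more
        opening brackets than \<open>{c..<x}\<close> holds closing ones. Subtracting this from the
        inequality at \<open>j\<close> leaves enough closing brackets in \<open>{x..j}\<close> to
        match \<open>x\<close>.\<close>
      have "\<not> P (x - 1)" using min[of "x-1"] x \<open>c < x\<close> by auto
      then have "card (X \<inter> {b..<x}) > card (Y \<inter> {c..<x})" using \<open>c < x\<close> unfolding P_def e by auto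
      then show ?thesis
        using j card_Icc_split[of b x j X] card_Icc_split[of c x j Y] x \<open>c < x\<close> by (simp add: P_def)
    qed
    then have "height X Y (Suc j) \<le> height X Y x"
      using height_diff[of x "Suc j" X Y] x by (simp add: atLeastLessThanSuc_atLeastAtMost)
    then obtain k where "arc X Y x k" using open_matched[OF x(1) d(1) x(3)] by blast
    then show ?thesis using arcs arcD(2) d(2) by blast
  qed
  moreover have "y \<in> Y'" if "y \<in> Y" for y
    using ballot_close_matched[OF assms(1) that] arcs arcD(4) d(2) by metis
  ultimately have "X \<inter> {b..j} = X' \<inter> {b..j}" "Y \<inter> {b..j} = Y' \<inter> {b..j}"
    using same_types[OF d(1,2), of "{b..j}"] d(3,4) by (simp_all add: subset_iff)
  moreover from this have "Y \<inter> {c..j} = Y' \<inter> {c..j}" using bc by fastforce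
  ultimately show ?thesis using j bc unfolding ascent_def P_def
    by (metis IntE IntI atLeastAtMost_iff less_imp_le order.refl order.trans)
qed

text \<open>An arc need not be an ascent, so its two ends are treated separately: \<open>b\<close>
  forms an ascent with the next closing bracket, and \<open>k\<close> with the last opening bracket
  before it. In both cases \<open>k\<close> is the witness.\<close>

lemma arcs_mono_if_ascents_mono:
  assumes "ballot m n X Y" "ballot m n X' Y'"
    and ascents: "\<And>b c. ascent X Y b c \<Longrightarrow> ascent X' Y' b c"
    and "arc X Y a l"
  shows "arc X' Y' a l"
proof (rule arcs_transfer[OF assms(1,2) _ assms(4)])
  fix b k assume arc: "arc X Y b k"
  have d: "X \<inter> Y = {}" using assms by (auto simp: ballot_def)
  note bk = arcD[OF arc d]
  have eq: "card (X \<inter> {b..k}) = card (Y \<inter> {b..k})"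
    using arc height_diff[of b "Suc k" X Y] bk by (simp add: arc_def atLeastLessThanSuc_atLeastAtMost)
  define c where "c = (LEAST c. c \<in> Y \<and> b < c)"
  have c: "c \<in> Y" "b < c" "c \<le> k" and minc: "\<And>y. y \<in> Y \<Longrightarrow> b < y \<Longrightarrow> c \<le> y"
    using LeastI[of "\<lambda>c. c \<in> Y \<and> b < c" k] Least_le[of "\<lambda>c. c \<in> Y \<and> b < c"] bk
    unfolding c_def by auto
  have "c \<le> y" if "y \<in> Y" "b \<le> y" for y
    using minc[of y] that bk(3) by (cases "y = b") auto
  then have "Y \<inter> {b..k} = Y \<inter> {c..k}" using c(2) by auto
  then have "ascent X Y b c" using c bk eq by (auto simp: ascent_def)
  define a where "a = (GREATEST a. a \<in> X \<and> a < k)"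
  have a: "a \<in> X" "a < k" and maxa: "\<And>x. x \<in> X \<Longrightarrow> x < k \<Longrightarrow> x \<le> a"
    using GreatestI_nat[of "\<lambda>a. a \<in> X \<and> a < k" b k] Greatest_le_nat[of "\<lambda>a. a \<in> X \<and> a < k" _ k] bk
    unfolding a_def by auto
  have "X \<inter> {a..k} = {a}"
    using maxa bk a by (fastforce simp: le_less)
  then have "ascent X Y a k" using a bk by (auto simp: ascent_def)
  then show "b \<in> X' \<and> k \<in> Y'"
    using ascents \<open>ascent X Y b c\<close> by (auto simp: ascent_def)
qed

text \<open>An arc is recorded by its closing end, so that this set is literally the second column
  of a projection.\<close>

definition arcs_within :: "nat set \<Rightarrow> nat set \<Rightarrow> nat \<Rightarrow> nat \<Rightarrow> nat set" where
  "arcs_within X Y i j = {k. k \<le> j \<and> (\<exists>a\<ge>i. arc X Y a k)}"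

lemma finite_arcs_within: "finite (arcs_within X Y i j)"
  by (rule finite_subset[of _ "{..j}"]) (auto simp: arcs_within_def)

text \<open>Half of the points of \<open>{b..k}\<close> are closing brackets with arcs inside. The
  second word has at least as many arcs there, and their opening ends \<open>A\<close> and closing
  ends \<open>C\<close> are disjoint, so together they exhaust \<open>{b..k}\<close>. The first
  point cannot be a closing end, nor the last an opening one.\<close>

lemma arcs_mono_if_card_mono:
  assumes "ballot m n X Y" "ballot m n X' Y'"
    and card: "\<And>i j. m \<le> i \<Longrightarrow> i < j \<Longrightarrow> j \<le> n \<Longrightarrow>
      card (arcs_within X Y i j) \<le> card (arcs_within X' Y' i j)"
    and "arc X Y a l"
  shows "arc X' Y' a l"
proof (rule arcs_transfer[OF assms(1,2) _ assms(4)])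
  fix b k assume arc: "arc X Y b k"
  have d: "X \<inter> Y = {}" "X' \<inter> Y' = {}" "X \<union> Y = {m..n}" "X' \<union> Y' = {m..n}"
    using assms by (auto simp: ballot_def)
  note bk = arcD[OF arc d(1)]
  have eq: "card (X \<inter> {b..k}) = card (Y \<inter> {b..k})"
    using arc height_diff[of b "Suc k" X Y] bk by (simp add: arc_def atLeastLessThanSuc_atLeastAtMost)
  have mn: "m \<le> b" "k \<le> n" using bk d by auto
  then have "{b..k} = (X \<inter> {b..k}) \<union> (Y \<inter> {b..k})" using d by auto
  then have "card {b..k} = card (X \<inter> {b..k}) + card (Y \<inter> {b..k})"
    using d by (subst \<open>{b..k} = _\<close>, subst card_Un_disjoint) auto
  moreover have "Y \<inter> {b..k} \<subseteq> arcs_within X Y b k"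
  proof
    fix y assume y: "y \<in> Y \<inter> {b..k}"
    then obtain a where "b \<le> a" "arc X Y a y"
      using close_in_arc_matched[OF arc d(1), of y] by auto
    then show "y \<in> arcs_within X Y b k" using y by (auto simp: arcs_within_def)
  qed
  then have "card (Y \<inter> {b..k}) \<le> card (arcs_within X Y b k)"
    by (rule card_mono[OF finite_arcs_within])
  ultimately have ge: "card {b..k} \<le> 2 * card (arcs_within X' Y' b k)"
    using card[of b k] bk mn eq by simp
  define C where "C = arcs_within X' Y' b k"
  define A where "A = {a. b \<le> a \<and> (\<exists>l\<le>k. arc X' Y' a l)}"
  have A: "A \<subseteq> X' \<inter> {b..<k}" and C: "C \<subseteq> Y' \<inter> {b<..k}"
    using arcD[OF _ d(2)] by (fastforce simp: A_def C_def arcs_within_def)+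
  have fin: "finite A" "finite C" using A C by (auto intro: finite_subset)
  have "\<forall>l\<in>C. \<exists>a. a \<in> A \<and> arc X' Y' a l" by (auto simp: A_def C_def arcs_within_def)
  then obtain f where f: "\<And>l. l \<in> C \<Longrightarrow> f l \<in> A \<and> arc X' Y' (f l) l" by metis
  have "inj_on f C" using f arc_close_unique by (metis inj_onI)
  then have "card C \<le> card A" using f fin by (intro card_inj_on_le[of f]) auto
  moreover have "card (A \<union> C) = card A + card C" using A C d fin by (intro card_Un_disjoint) auto
  ultimately have "card {b..k} \<le> card (A \<union> C)" using ge by (simp add: C_def)
  moreover have "A \<union> C \<subseteq> {b..k}" using A C by auto
  ultimately have "A \<union> C = {b..k}" by (meson card_seteq finite_atLeastAtMost)
  then have "b \<in> A \<union> C" "k \<in> A \<union> C" using bk(1) by auto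
  then have "b \<in> A" "k \<in> C" using A C by auto
  then show "b \<in> X' \<and> k \<in> Y'" using A C by auto
qed

text \<open>\<open>Xi\<close> and \<open>Yi\<close> describe what remains once the entries before
  \<open>i\<close> are removed: closing brackets that lost their match have become opening ones.
  Below an arc that starts at \<open>i\<close> or later nothing changes, since closing brackets
  there are matched inside it. Conversely, each element of \<open>Yi\<close> already ends an old
  arc, and an end determines its arc.\<close>

lemma arc_truncate:
  assumes "ballot m n X Y" "m \<le> i"
    and Yi: "Yi = {k. \<exists>a\<ge>i. arc X Y a k}" and Xi: "Xi = {i..n} - Yi" and "i \<le> a"
  shows "arc Xi Yi a k \<longleftrightarrow> arc X Y a k"
proof -
  have d: "X \<inter> Y = {}" "X \<union> Y = {m..n}" using assms by (auto simp: ballot_def)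
  have imp: "arc Xi Yi b l" if arc: "arc X Y b l" and "i \<le> b" for b l
  proof -
    note bl = arcD[OF arc d(1)]
    have "y \<in> Yi" if y: "y \<in> Y" "b \<le> y" "y \<le> l" for y
    proof -
      obtain a where "b \<le> a" "arc X Y a y" using close_in_arc_matched[OF arc d(1) y] .
      then show ?thesis using \<open>i \<le> b\<close> unfolding Yi by (blast intro: order.trans)
    qed
    moreover have "Yi \<subseteq> Y" using arcD(4)[OF _ d(1)] unfolding Yi by blast
    ultimately have "Y \<inter> {b..l} = Yi \<inter> {b..l}" by auto
    moreover from this have "X \<inter> {b..l} = Xi \<inter> {b..l}"
      using d bl \<open>m \<le> i\<close> \<open>i \<le> b\<close> unfolding Xi by auto
    ultimately show ?thesis using arc arc_cong by blast
  qed
  moreover have "arc X Y a k" if "arc Xi Yi a k"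
  proof -
    have "Xi \<inter> Yi = {}" by (auto simp: Xi)
    then have "k \<in> Yi" using arcD that by blast
    then obtain b where "arc X Y b k" "i \<le> b" by (auto simp: Yi)
    then show ?thesis using imp arc_open_unique that by metis
  qed
  ultimately show ?thesis using \<open>i \<le> a\<close> by blast
qed

section \<open>Jeu de taquin\<close>

text \<open>All comparable boxes are compared, not only neighbours, and the domain need not be a
  diagram: the condition must remain strong enough while a hole interrupts rows and columns.\<close>

definition monotone_filling :: "tableau \<Rightarrow> bool" where
  "monotone_filling T \<longleftrightarrow> inj_on T (dom T) \<and>
     (\<forall>p q x y. T p = Some x \<and> T q = Some y \<and> fst p \<le> fst q \<and> snd p \<le> snd q \<and> p \<noteq> q \<longrightarrow> x < y)"

lemma monotone_fillingD:
  assumes "monotone_filling T" "T p = Some x" "T q = Some y" "fst p \<le> fst q" "snd p \<le> snd q" "p \<noteq> q"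
  shows "x < y"
  using assms unfolding monotone_filling_def by blast

lemma filling_inj:
  assumes "monotone_filling T" "T p = Some x" "T q = Some x"
  shows "p = q"
  using assms unfolding monotone_filling_def by (metis domI inj_on_contraD)

lemma young_diagramD:
  assumes "young_diagram D" "(r, c) \<in> D" "r' \<le> r" "c' \<le> c"
  shows "(r', c') \<in> D"
  using assms unfolding young_diagram_def by blast

lemma young_diagram_box:
  assumes "young_diagram D" "q \<in> D" "fst p \<le> fst q" "snd p \<le> snd q"
  shows "p \<in> D"
  using young_diagramD[OF assms(1), of "fst q" "snd q" "fst p" "snd p"] assms by simp

text \<open>Comparable boxes are joined by a path along a column and a row of the diagram. This
  gives a weak inequality, and injectivity makes it strict.\<close>

lemma young_tableau_iff_monotone_filling:
  "young_tableau E T \<longleftrightarrow> 0 \<notin> E \<and> young_diagram (dom T) \<and> ran T = E \<and> monotone_filling T"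
proof
  assume T: "young_tableau E T"
  then have yd: "young_diagram (dom T)"
    and row: "\<And>r c x y. T (r, c) = Some x \<Longrightarrow> T (r, Suc c) = Some y \<Longrightarrow> x < y"
    and col: "\<And>r c x y. T (r, c) = Some x \<Longrightarrow> T (Suc r, c) = Some y \<Longrightarrow> x < y"
    unfolding young_tableau_def by blast+
  have R: "x \<le> y" if "T (r, c) = Some x" "T (r, c + d) = Some y" for r c d x y
    using that
  proof (induction d arbitrary: y)
    case (Suc d)
    have "(r, c + d) \<in> dom T" by (rule young_diagramD[OF yd domI[of T, OF Suc.prems(2)]]) auto
    then obtain z where "T (r, c + d) = Some z" by auto
    then show ?case using Suc.IH[of z] Suc.prems row[of r "c + d" z y] by simp
  qed auto
  have C: "x \<le> y" if "T (r, c) = Some x" "T (r + d, c) = Some y" for r c d x y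
    using that
  proof (induction d arbitrary: y)
    case (Suc d)
    have "(r + d, c) \<in> dom T" by (rule young_diagramD[OF yd domI[of T, OF Suc.prems(2)]]) auto
    then obtain z where "T (r + d, c) = Some z" by auto
    then show ?case using Suc.IH[of z] Suc.prems col[of "r + d" c z y] by simp
  qed auto
  have inj: "inj_on T (dom T)" using T by (auto simp: young_tableau_def)
  have "x < y" if pq: "T p = Some x" "T q = Some y" "fst p \<le> fst q" "snd p \<le> snd q" "p \<noteq> q" for p q x y
  proof -
    obtain r c where p: "p = (r, c)" by (cases p)
    obtain d e where q: "q = (r + d, c + e)"
      using pq(3,4) p by (cases q) (auto dest!: le_Suc_ex)
    have "(r, c + e) \<in> dom T" by (rule young_diagramD[OF yd domI[of T, OF pq(2)[unfolded q]]]) auto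
    then obtain z where "T (r, c + e) = Some z" by auto
    then have "x \<le> y" using R[of r c x e z] C[of r "c + e" z d y] pq p q by simp
    moreover have "x \<noteq> y" using pq inj by (metis domI inj_on_contraD)
    ultimately show ?thesis by simp
  qed
  then show "0 \<notin> E \<and> young_diagram (dom T) \<and> ran T = E \<and> monotone_filling T"
    using T inj unfolding young_tableau_def monotone_filling_def by blast
next
  assume T: "0 \<notin> E \<and> young_diagram (dom T) \<and> ran T = E \<and> monotone_filling T"
  then have m: "\<And>p q x y. T p = Some x \<Longrightarrow> T q = Some y \<Longrightarrow> fst p \<le> fst q \<Longrightarrow> snd p \<le> snd q
    \<Longrightarrow> p \<noteq> q \<Longrightarrow> x < y"
    unfolding monotone_filling_def by blast
  have "x < y" if "T (r, c) = Some x" "T (r, Suc c) = Some y" for r c x y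
    using m[OF that] by auto
  moreover have "x < y" if "T (r, c) = Some x" "T (Suc r, c) = Some y" for r c x y
    using m[OF that] by auto
  ultimately show "young_tableau E T" using T unfolding young_tableau_def monotone_filling_def by blast
qed

section \<open>Invariants of a slide\<close>

lemma box_of_eq:
  assumes "monotone_filling T" "T p = Some a"
  shows "box_of T a = p"
  unfolding box_of_def by (rule the_equality) (use assms filling_inj in blast)+

lemma young_diagram_remove:
  assumes "young_diagram D" "\<And>q. q \<in> D \<Longrightarrow> fst h \<le> fst q \<Longrightarrow> snd h \<le> snd q \<Longrightarrow> q = h"
  shows "young_diagram (D - {h})"
  using assms unfolding young_diagram_def by (metis Diff_iff finite_Diff fst_conv singletonD singletonI snd_conv)

lemma slide_source_cases:
  "slide_source T h = None \<Longrightarrow> T (fst h, Suc (snd h)) = None \<and> T (Suc (fst h), snd h) = None"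
  "slide_source T h = Some h' \<Longrightarrow> \<exists>x. T h' = Some x \<and>
     (h' = (fst h, Suc (snd h)) \<and> (\<forall>y. T (Suc (fst h), snd h) = Some y \<longrightarrow> x < y) \<or>
      h' = (Suc (fst h), snd h) \<and> (\<forall>y. T (fst h, Suc (snd h)) = Some y \<longrightarrow> x \<le> y))"
  by (auto simp: slide_source_def Let_def split: option.splits if_splits)

lemma slide_stop: "slide_source T h = None \<Longrightarrow> slide T h = T(h := None)"
  by (subst slide.simps) simp

lemma slide_step: "slide_source T h = Some h' \<Longrightarrow> slide T h = slide (T(h := T h')) h'"
  by (subst slide.simps) simp

text \<open>The stale entry in the hole keeps the domain constant during a slide, so the number of
  its boxes weakly below and to the right of the hole decreases.\<close>

lemma slide_induct [consumes 2, case_names stop step]: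
  assumes "finite (dom T)" "h \<in> dom T"
    and stop: "\<And>T h. finite (dom T) \<Longrightarrow> h \<in> dom T \<Longrightarrow> slide_source T h = None \<Longrightarrow> P T h"
    and step: "\<And>T h h'. finite (dom T) \<Longrightarrow> h \<in> dom T \<Longrightarrow> slide_source T h = Some h' \<Longrightarrow>
      P (T(h := T h')) h' \<Longrightarrow> P T h"
  shows "P T h"
  using assms(1,2)
proof (induction "card {q \<in> dom T. fst h \<le> fst q \<and> snd h \<le> snd q}" arbitrary: T h rule: less_induct)
  case less
  show ?case
  proof (cases "slide_source T h")
    case None
    then show ?thesis using stop less.prems by blast
  next
    case (Some h')
    note s = slide_source_cases(2)[OF Some]
    let ?T = "T(h := T h')"
    have d: "dom ?T = dom T" "h' \<in> dom T" using s less.prems by auto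
    have le: "fst h \<le> fst h'" "snd h \<le> snd h'" "\<not> (fst h' \<le> fst h \<and> snd h' \<le> snd h)" using s by auto
    have "{q \<in> dom ?T. fst h' \<le> fst q \<and> snd h' \<le> snd q} \<subset> {q \<in> dom T. fst h \<le> fst q \<and> snd h \<le> snd q}"
      using le less.prems unfolding d by fastforce
    then have "card {q \<in> dom ?T. fst h' \<le> fst q \<and> snd h' \<le> snd q} <
      card {q \<in> dom T. fst h \<le> fst q \<and> snd h \<le> snd q}"
      using less.prems by (intro psubset_card_mono) auto
    then have "P ?T h'" using less.hyps[of ?T h'] less.prems d by auto
    then show ?thesis using step[OF less.prems Some] by blast
  qed
qed

text \<open>The hole counts as a box of the diagram but its stale entry must not count in the
  filling. So the shape is stated for \<open>T\<close> and monotonicity for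
  \<open>T(h := None)\<close>.\<close>

lemma slide_preserves:
  assumes "finite (dom T)" "h \<in> dom T" "young_diagram (dom T)" "monotone_filling (T(h := None))"
  shows "young_diagram (dom (slide T h)) \<and> monotone_filling (slide T h) \<and>
    ran (slide T h) = ran (T(h := None)) \<and> dom (slide T h) \<subseteq> dom T \<and>
    (\<forall>p. \<not> (fst h \<le> fst p \<and> snd h \<le> snd p) \<longrightarrow> slide T h p = T p)"
  using assms
proof (induction rule: slide_induct)
  case (stop T h)
  note none = slide_source_cases(1)[OF stop(3)]
  have "q = h" if "q \<in> dom T" "fst h \<le> fst q" "snd h \<le> snd q" for q
  proof (rule ccontr)
    assume "q \<noteq> h"
    then have "Suc (fst h) \<le> fst q \<or> Suc (snd h) \<le> snd q" using that by (cases h, cases q) auto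
    then have "(Suc (fst h), snd h) \<in> dom T \<or> (fst h, Suc (snd h)) \<in> dom T"
      using young_diagramD[OF stop(4), of "fst q" "snd q"] that by auto
    then show False using none by auto
  qed
  then have "young_diagram (dom T - {h})" using young_diagram_remove[OF stop(4)] by blast
  then have "young_diagram (dom (T(h := None)))" by simp
  then show ?case using stop(5) by (auto simp add: slide_stop[OF stop(3)] simp del: fun_upd_apply dom_fun_upd)
      (auto split: if_splits)
next
  case (step T h h')
  from slide_source_cases(2)[OF step(3)] obtain v where v: "T h' = Some v" and
    src: "h' = (fst h, Suc (snd h)) \<and> (\<forall>y. T (Suc (fst h), snd h) = Some y \<longrightarrow> v < y) \<or>
      h' = (Suc (fst h), snd h) \<and> (\<forall>y. T (fst h, Suc (snd h)) = Some y \<longrightarrow> v \<le> y)" by blast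
  let ?U = "T(h := None)" and ?T = "T(h := T h')"
  let ?V = "?T(h' := None)"
  have neq: "h' \<noteq> h" and le: "fst h \<le> fst h'" "snd h \<le> snd h'" using src by (cases h; auto)+
  have Uh': "?U h' = Some v" using v neq by simp
  have dom: "dom ?T = dom T" using step(2) v by auto
  have from_U: "\<exists>p'. ?U p' = Some x \<and> (p = h \<and> p' = h' \<and> x = v \<or> p \<noteq> h \<and> p \<noteq> h' \<and> p' = p)"
    if "?V p = Some x" for p x
  proof (cases "p = h")
    case True
    then show ?thesis using that v neq by (intro exI[of _ h']) simp
  next
    case False
    then show ?thesis using that by (intro exI[of _ p]) (simp split: if_splits)
  qed
  \<comment> \<open>Any other box weakly below and to the right of the hole lies beyond one of the
    two neighbours of the hole, and \<open>v\<close> is the smaller neighbouring entry. So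
    \<open>v\<close> may move into the hole.\<close>
  have low: "v < y" if q: "?U q = Some y" "fst h \<le> fst q" "snd h \<le> snd q" "q \<noteq> h'" for q y
  proof -
    have "q \<noteq> h" "T q = Some y" using q by (auto split: if_splits)
    then have "Suc (fst h) \<le> fst q \<or> Suc (snd h) \<le> snd q" using q by (cases h, cases q) auto
    then obtain g where g: "g = (Suc (fst h), snd h) \<or> g = (fst h, Suc (snd h))"
      "fst g \<le> fst q" "snd g \<le> snd q" using q(2,3) by (metis fst_conv snd_conv)
    then have "g \<in> dom T" using young_diagram_box[OF step(5)] \<open>T q = Some y\<close> by blast
    then obtain z where z: "T g = Some z" by auto
    have gh: "g \<noteq> h" using g(1) by (cases h) auto
    have "z \<le> y"
      using monotone_fillingD[OF step(6), of g z q y] z gh q g \<open>T q = Some y\<close> by (cases "g = q") auto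
    moreover have "v \<le> z" using src g z v by auto
    moreover have "v \<noteq> y" using filling_inj[OF step(6) Uh'] q by blast
    ultimately show ?thesis by simp
  qed
  have mono: "monotone_filling ?V"
    unfolding monotone_filling_def
  proof (intro conjI allI impI)
    show "inj_on ?V (dom ?V)"
    proof (rule inj_onI)
      fix p q assume pq: "p \<in> dom ?V" "q \<in> dom ?V" "?V p = ?V q"
      then obtain x where x: "?V p = Some x" "?V q = Some x" by (metis domD)
      show "p = q" using from_U[OF x(1)] from_U[OF x(2)] filling_inj[OF step(6)] by blast
    qed
  next
    fix p q x y
    assume "?V p = Some x \<and> ?V q = Some y \<and> fst p \<le> fst q \<and> snd p \<le> snd q \<and> p \<noteq> q"
    then have a: "?V p = Some x" "?V q = Some y" and l: "fst p \<le> fst q" "snd p \<le> snd q" "p \<noteq> q"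
      by blast+
    obtain p' where p': "?U p' = Some x" "p = h \<and> p' = h' \<and> x = v \<or> p \<noteq> h \<and> p \<noteq> h' \<and> p' = p"
      using from_U[OF a(1)] by blast
    obtain q' where q': "?U q' = Some y" "q = h \<and> q' = h' \<and> y = v \<or> q \<noteq> h \<and> q \<noteq> h' \<and> q' = q"
      using from_U[OF a(2)] by blast
    show "x < y"
    proof (cases "p = h")
      case True
      then show ?thesis using low[OF q'(1)] p' q' l by auto
    next
      case False
      then have "p' = p" "p \<noteq> h'" using p' by auto
      have "fst p \<le> fst q'" "snd p \<le> snd q'" "p \<noteq> q'" using l q' le \<open>p \<noteq> h'\<close> by auto
      then show ?thesis using monotone_fillingD[OF step(6) p'(1) q'(1)] \<open>p' = p\<close> by simp
    qed
  qed
  have ran: "ran ?V = ran ?U"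
  proof
    show "ran ?V \<subseteq> ran ?U" using from_U unfolding ran_def by blast
    show "ran ?U \<subseteq> ran ?V"
    proof
      fix x assume "x \<in> ran ?U"
      then obtain p where "?U p = Some x" by (auto simp: ran_def)
      then have "?V (if p = h' then h else p) = Some x" using neq by (auto split: if_splits)
      then show "x \<in> ran ?V" by (rule ranI)
    qed
  qed
  have sl: "young_diagram (dom (slide ?T h')) \<and> monotone_filling (slide ?T h') \<and>
    ran (slide ?T h') = ran ?U \<and> dom (slide ?T h') \<subseteq> dom T \<and>
    (\<forall>p. \<not> (fst h' \<le> fst p \<and> snd h' \<le> snd p) \<longrightarrow> slide ?T h' p = ?T p)"
    using step.IH[unfolded dom ran, OF step(5) mono] .
  have "slide ?T h' p = T p" if "\<not> (fst h \<le> fst p \<and> snd h \<le> snd p)" for p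
  proof -
    have "\<not> (fst h' \<le> fst p \<and> snd h' \<le> snd p)" "p \<noteq> h" using that le by auto
    then have "slide ?T h' p = ?T p" using sl by blast
    then show ?thesis using \<open>p \<noteq> h\<close> by simp
  qed
  then show ?case using sl unfolding slide_step[OF step(3)] by blast
qed

text \<open>The hole only visits boxes weakly below and to the right of the box of \<open>a\<close>,
  and these hold no entry smaller than \<open>a\<close>. The last claim will show that removing
  large entries leaves the small ones in place.\<close>

lemma jdt_remove_preserves:
  assumes "young_tableau E T" "T p = Some a"
  shows "young_tableau (E - {a}) (jdt_remove a T)" "dom (jdt_remove a T) \<subseteq> dom T"
    "\<And>q x. T q = Some x \<Longrightarrow> x < a \<Longrightarrow> jdt_remove a T q = Some x"
proof -
  have T: "0 \<notin> E" "young_diagram (dom T)" "ran T = E" "monotone_filling T"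
    using assms(1) by (auto simp: young_tableau_iff_monotone_filling)
  have box: "box_of T a = p" using box_of_eq T assms by blast
  have m: "monotone_filling (T(p := None))"
    unfolding monotone_filling_def
  proof (intro conjI allI impI)
    show "inj_on (T(p := None)) (dom (T(p := None)))"
      using filling_inj[OF T(4)] by (auto simp: inj_on_def split: if_splits)
  next
    fix q q' x y
    assume "(T(p := None)) q = Some x \<and> (T(p := None)) q' = Some y \<and>
      fst q \<le> fst q' \<and> snd q \<le> snd q' \<and> q \<noteq> q'"
    then show "x < y" using monotone_fillingD[OF T(4), of q x q' y] by (simp split: if_splits)
  qed
  have "finite (dom T)" using T(2) by (auto simp: young_diagram_def)
  note s = slide_preserves[OF this domI[of T, OF assms(2)] T(2) m]
  have "ran (T(p := None)) = E - {a}"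
  proof -
    have "x \<in> ran (T(p := None)) \<longleftrightarrow> x \<in> ran T \<and> x \<noteq> a" for x
    proof -
      have "x \<in> ran (T(p := None)) \<longleftrightarrow> (\<exists>q. q \<noteq> p \<and> T q = Some x)"
        unfolding ran_def by (auto split: if_splits)
      also have "\<dots> \<longleftrightarrow> x \<in> ran T \<and> x \<noteq> a"
        using filling_inj[OF T(4) assms(2)] assms(2) unfolding ran_def by fastforce
      finally show ?thesis .
    qed
    then show ?thesis using T(3) by auto
  qed
  then show "young_tableau (E - {a}) (jdt_remove a T)" "dom (jdt_remove a T) \<subseteq> dom T"
    using s T(1) by (auto simp: young_tableau_iff_monotone_filling jdt_remove_def box)
  fix q x assume q: "T q = Some x" "x < a"
  have "\<not> (fst p \<le> fst q \<and> snd p \<le> snd q)"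
    using monotone_fillingD[OF T(4) assms(2) q(1)] q assms(2) by fastforce
  then have "slide T p q = T q" using s by blast
  then show "jdt_remove a T q = Some x" using q by (simp add: jdt_remove_def box)
qed

section \<open>Two-column tableaux and their projections\<close>

definition col :: "tableau \<Rightarrow> nat \<Rightarrow> nat set" where
  "col T c = {v. \<exists>r. T (r, c) = Some v}"

text \<open>The entry set is arbitrary because a deletion may take an entry out of the middle of an
  interval.\<close>

definition two_column :: "nat set \<Rightarrow> tableau \<Rightarrow> bool" where
  "two_column E T \<longleftrightarrow> young_tableau E T \<and> (\<forall>p\<in>dom T. snd p < 2)"

lemma two_columnD:
  assumes "two_column E T"
  shows "young_tableau E T" "young_diagram (dom T)" "finite (dom T)" "ran T = E"
    "monotone_filling T" "finite E" "\<And>p v. T p = Some v \<Longrightarrow> snd p < 2"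
proof -
  show yt: "young_tableau E T" and "\<And>p v. T p = Some v \<Longrightarrow> snd p < 2"
    using assms by (auto simp: two_column_def)
  then show "young_diagram (dom T)" "ran T = E" "monotone_filling T"
    by (auto simp: young_tableau_iff_monotone_filling)
  then show "finite (dom T)" by (simp add: young_diagram_def)
  then show "finite E" using finite_ran \<open>ran T = E\<close> by blast
qed

lemma two_column_cols:
  assumes "two_column E T"
  shows "col T 0 \<union> col T 1 = E" "col T 0 \<inter> col T 1 = {}"
proof -
  note T = two_columnD[OF assms]
  have "v \<in> col T 0 \<union> col T 1" if v: "v \<in> E" for v
  proof -
    obtain r c where rc: "T (r, c) = Some v" using v T(4) by (auto simp: ran_def)
    then have "c = 0 \<or> c = 1" using T(7)[OF rc] by auto
    then show ?thesis using rc by (auto simp: col_def)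
  qed
  moreover have "col T c \<subseteq> E" for c using T(4) by (auto simp: col_def intro: ranI)
  ultimately show "col T 0 \<union> col T 1 = E" by blast
  show "col T 0 \<inter> col T 1 = {}" using filling_inj[OF T(5)] by (fastforce simp: col_def)
qed

lemma col_less_iff:
  assumes "monotone_filling T" "T (r, c) = Some x" "T (s, c) = Some y"
  shows "x < y \<longleftrightarrow> r < s" "x \<le> y \<longleftrightarrow> r \<le> s"
proof -
  consider "r < s" | "r = s" | "s < r" by linarith
  then have "(x < y \<longleftrightarrow> r < s) \<and> (x \<le> y \<longleftrightarrow> r \<le> s)"
  proof cases
    case 1
    then show ?thesis using monotone_fillingD[OF assms] by auto
  next
    case 2
    then show ?thesis using assms by simp
  next
    case 3
    then show ?thesis using monotone_fillingD[OF assms(1,3,2)] by auto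
  qed
  then show "x < y \<longleftrightarrow> r < s" "x \<le> y \<longleftrightarrow> r \<le> s" by blast+
qed

text \<open>This turns rows into heights: an entry has as many entries above it in its column as its
  row number, which counts from 0.\<close>

lemma card_col_atMost:
  assumes "monotone_filling T" "young_diagram (dom T)" "T (r, c) = Some x"
  shows "card (col T c \<inter> {..x}) = Suc r"
proof -
  have ex: "\<exists>v. T (s, c) = Some v" if "s \<le> r" for s
    using young_diagramD[OF assms(2) domI[of T, OF assms(3)] that, of c] by auto
  have "bij_betw (\<lambda>s. the (T (s, c))) {..r} (col T c \<inter> {..x})"
  proof (rule bij_betwI')
    fix s t assume "s \<in> {..r}" "t \<in> {..r}"
    then obtain v w where "T (s, c) = Some v" "T (t, c) = Some w" using ex by (meson atMost_iff)
    then show "the (T (s, c)) = the (T (t, c)) \<longleftrightarrow> s = t"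
      using filling_inj[OF assms(1)] by auto
  next
    fix s assume "s \<in> {..r}"
    then obtain v where "T (s, c) = Some v" "s \<le> r" using ex by auto
    then show "the (T (s, c)) \<in> col T c \<inter> {..x}"
      using col_less_iff(2)[OF assms(1) _ assms(3)] by (auto simp: col_def)
  next
    fix v assume "v \<in> col T c \<inter> {..x}"
    then obtain s where "T (s, c) = Some v" "v \<le> x" by (auto simp: col_def)
    then show "\<exists>s\<in>{..r}. v = the (T (s, c))"
      using col_less_iff(2)[OF assms(1) _ assms(3)] by force
  qed
  then show ?thesis using bij_betw_same_card by fastforce
qed

lemma column_length_eq_card_col:
  assumes "monotone_filling T"
  shows "column_length T c = card (col T c)"
proof -
  have "bij_betw (\<lambda>r. the (T (r, c))) {r. (r, c) \<in> dom T} (col T c)"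
  proof (rule bij_betwI')
    fix r s assume "r \<in> {r. (r, c) \<in> dom T}" "s \<in> {r. (r, c) \<in> dom T}"
    then obtain v w where "T (r, c) = Some v" "T (s, c) = Some w" by blast
    then show "the (T (r, c)) = the (T (s, c)) \<longleftrightarrow> r = s" using filling_inj[OF assms] by auto
  next
    fix v assume "v \<in> col T c"
    then obtain r where "T (r, c) = Some v" by (auto simp: col_def)
    then show "\<exists>r\<in>{r. (r, c) \<in> dom T}. v = the (T (r, c))" by (intro bexI[of _ r]) auto
  qed (auto simp: col_def)
  then show ?thesis unfolding column_length_def by (rule bij_betw_same_card)
qed

lemma finite_col: "two_column E T \<Longrightarrow> finite (col T c)"
  using two_columnD(4,6)[of E T] by (auto simp: col_def intro: ranI finite_subset[of _ E])

lemma left_entry: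
  assumes "two_column E T" "T (r, 1) = Some y"
  obtains x where "T (r, 0) = Some x" "x < y"
proof -
  note T = two_columnD[OF assms(1)]
  have "(r, 0) \<in> dom T" using young_diagramD[OF T(2) domI[of T, OF assms(2)]] by simp
  then obtain x where x: "T (r, 0) = Some x" by auto
  moreover have "x < y" using monotone_fillingD[OF T(5) x assms(2)] by simp
  ultimately show ?thesis using that by blast
qed

lemma greatest_below:
  assumes "two_column E T" "col T 1 \<inter> {..<x} \<noteq> {}"
  obtains r y where "T (r, 1) = Some y" "y < x" "col T 1 \<inter> {..<x} = col T 1 \<inter> {..y}"
proof -
  define y where "y = Max (col T 1 \<inter> {..<x})"
  have y: "y \<in> col T 1 \<inter> {..<x}" "\<And>v. v \<in> col T 1 \<inter> {..<x} \<Longrightarrow> v \<le> y"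
    using assms(2) finite_col[OF assms(1), of 1] Max_in[of "col T 1 \<inter> {..<x}"]
    unfolding y_def by auto
  then have "col T 1 \<inter> {..<x} = col T 1 \<inter> {..y}" by auto
  then show ?thesis using that y by (auto simp: col_def)
qed

text \<open>The last closing bracket before \<open>x\<close>, in row \<open>r\<close>, is the
  closing bracket number \<open>Suc r\<close>. Its left neighbour is smaller and is the opening
  bracket number \<open>Suc r\<close>.\<close>

lemma two_column_ballot:
  assumes "two_column {m..n} T"
  shows "ballot m n (col T 0) (col T 1)"
  unfolding ballot_def
proof (intro conjI allI)
  note T = two_columnD[OF assms]
  fix x
  show "0 \<le> height (col T 0) (col T 1) x"
  proof (cases "col T 1 \<inter> {..<x} = {}")
    case False
    then obtain r y where y: "T (r, 1) = Some y" "y < x" "col T 1 \<inter> {..<x} = col T 1 \<inter> {..y}"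
      using greatest_below[OF assms] by metis
    obtain z where z: "T (r, 0) = Some z" "z < y" using left_entry[OF assms y(1)] .
    have "card (col T 0 \<inter> {..z}) \<le> card (col T 0 \<inter> {..<x})" using z(2) y(2) by (intro card_mono) auto
    then show ?thesis
      using card_col_atMost[OF T(5,2) z(1)] card_col_atMost[OF T(5,2) y(1)] y(3)
      by (simp add: height_def)
  qed (simp add: height_def)
qed (use two_column_cols[OF assms] in blast)+

text \<open>The path of the hole down the first column turns right in the first row r with turns T r.\<close>

definition turns :: "tableau \<Rightarrow> nat \<Rightarrow> bool" where
  "turns T r \<longleftrightarrow> (\<exists>x. T (r, 1) = Some x \<and> (\<forall>y. T (Suc r, 0) = Some y \<longrightarrow> x < y))"

text \<open>\<open>v\<close> is the entry that changes from the second column to the first when the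
  hole starts in row \<open>s\<close> of the first column; there is none if the hole runs straight
  down.\<close>

definition first_turn :: "tableau \<Rightarrow> nat \<Rightarrow> nat \<Rightarrow> bool" where
  "first_turn T s v \<longleftrightarrow>
     (\<exists>r\<ge>s. T (r, 1) = Some v \<and> turns T r \<and> (\<forall>q. s \<le> q \<and> q < r \<longrightarrow> \<not> turns T q))"

lemma slide_first_column_unchanged:
  assumes "finite (dom T)" "h \<in> dom T" "0 < snd h"
  shows "slide T h (r, 0) = T (r, 0)"
  using assms
proof (induction rule: slide_induct)
  case (stop T h)
  then show ?case by (auto simp: slide_stop)
next
  case (step T h h')
  then have "0 < snd h'" using slide_source_cases(2)[OF step(3)] by auto
  then have "slide (T(h := T h')) h' (r, 0) = (T(h := T h')) (r, 0)" using step.IH by blast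
  also have "\<dots> = T (r, 0)" using step(5) by auto
  finally show ?case by (simp only: slide_step[OF step(3)])
qed

text \<open>A step down only shifts an entry within the first column. The step to the right brings
  in one entry, and afterwards the hole never returns to the first column.\<close>

lemma slide_first_column:
  assumes "finite (dom T)" "h \<in> dom T" "snd h = 0" "young_diagram (dom T)"
  shows "col (slide T h) 0 = {v. \<exists>r. r \<noteq> fst h \<and> T (r, 0) = Some v} \<union> {v. first_turn T (fst h) v}"
  using assms
proof (induction rule: slide_induct)
  case (stop T h)
  obtain s where h: "h = (s, 0)" using stop(4) by (cases h) auto
  have none: "T (s, 1) = None" using slide_source_cases(1)[OF stop(3)] h by simp
  have "\<not> first_turn T s v" for v
  proof
    assume "first_turn T s v"
    then obtain r where "s \<le> r" "T (r, 1) = Some v" by (auto simp: first_turn_def)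
    then have "(s, 1) \<in> dom T" using young_diagramD[OF stop(5), of r 1 s 1] by auto
    then show False using none by auto
  qed
  moreover have "col (slide T h) 0 = {v. \<exists>r. r \<noteq> s \<and> T (r, 0) = Some v}"
    unfolding slide_stop[OF stop(3)] col_def by (auto simp: h)
  ultimately show ?case by (simp add: h)
next
  case (step T h h')
  obtain s where h: "h = (s, 0)" using step(5) by (cases h) auto
  obtain v where v: "T h' = Some v" and
    src: "h' = (s, 1) \<and> (\<forall>y. T (Suc s, 0) = Some y \<longrightarrow> v < y) \<or>
      h' = (Suc s, 0) \<and> (\<forall>y. T (s, 1) = Some y \<longrightarrow> v \<le> y)"
    using slide_source_cases(2)[OF step(3)] h by auto
  let ?T = "T(h := T h')"
  have dom: "dom ?T = dom T" "h' \<in> dom T" using step(2) v by auto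
  note sl = slide_step[OF step(3)]
  from src show ?case
  proof
    assume right: "h' = (s, 1) \<and> (\<forall>y. T (Suc s, 0) = Some y \<longrightarrow> v < y)"
    then have "turns T s" using v by (auto simp: turns_def)
    then have "first_turn T s w \<longleftrightarrow> w = v" for w
      using right v unfolding first_turn_def by (auto simp: le_less)
    moreover have "slide ?T h' (r, 0) = ?T (r, 0)" for r
      using slide_first_column_unchanged[of ?T h'] step(1) dom right by auto
    ultimately show ?thesis unfolding sl col_def using v h by auto
  next
    assume below: "h' = (Suc s, 0) \<and> (\<forall>y. T (s, 1) = Some y \<longrightarrow> v \<le> y)"
    then have "\<not> turns T s" using v by (fastforce simp: turns_def)
    have same: "turns ?T r = turns T r" "?T (r, 1) = T (r, 1)" if "Suc s \<le> r" for r
      using that by (auto simp: turns_def h)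
    have "first_turn ?T (Suc s) w \<longleftrightarrow> first_turn T s w" for w
    proof
      assume "first_turn ?T (Suc s) w"
      then obtain r where "Suc s \<le> r" "T (r, 1) = Some w" "turns T r"
        "\<And>q. Suc s \<le> q \<Longrightarrow> q < r \<Longrightarrow> \<not> turns T q"
        unfolding first_turn_def using same by auto
      then show "first_turn T s w"
        using \<open>\<not> turns T s\<close> unfolding first_turn_def by (metis Suc_leD Suc_leI le_neq_implies_less)
    next
      assume "first_turn T s w"
      then obtain r where r: "s \<le> r" "T (r, 1) = Some w" "turns T r"
        "\<And>q. s \<le> q \<Longrightarrow> q < r \<Longrightarrow> \<not> turns T q"
        unfolding first_turn_def by auto
      then have "Suc s \<le> r" using \<open>\<not> turns T s\<close> by (cases "s = r") auto
      then show "first_turn ?T (Suc s) w"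
        using r same unfolding first_turn_def by (metis Suc_leD)
    qed
    moreover have "col (slide ?T h') 0 =
      {w. \<exists>r. r \<noteq> fst h' \<and> ?T (r, 0) = Some w} \<union> {w. first_turn ?T (fst h') w}"
    proof (rule step.IH)
      show "snd h' = 0" using below by simp
      show "young_diagram (dom ?T)" using step(6) by (simp only: dom(1))
    qed
    \<comment> \<open>The entry \<open>v\<close> has moved from row \<open>Suc s\<close> to row
      \<open>s\<close>; its stale copy sits in the new hole, which is excluded.\<close>
    moreover have "(\<exists>r. r \<noteq> Suc s \<and> ?T (r, 0) = Some w) \<longleftrightarrow> (\<exists>r. r \<noteq> s \<and> T (r, 0) = Some w)" for w
    proof -
      have 1: "T (Suc s, 0) = Some v" using below v by simp
      have "?T (r, 0) = (if r = s then Some v else T (r, 0))" for r using v h by simp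
      then have "(\<exists>r. r \<noteq> Suc s \<and> ?T (r, 0) = Some w) \<longleftrightarrow>
        w = v \<or> (\<exists>r. r \<noteq> Suc s \<and> r \<noteq> s \<and> T (r, 0) = Some w)" by (metis n_not_Suc_n option.inject)
      also have "\<dots> \<longleftrightarrow> (\<exists>r. r \<noteq> s \<and> T (r, 0) = Some w)"
        using 1 by (metis n_not_Suc_n option.inject)
      finally show ?thesis .
    qed
    ultimately show ?thesis unfolding sl using below h by simp
  qed
qed

lemma least_entry_box:
  assumes "two_column {m..n} T" "m \<le> n"
  shows "T (0, 0) = Some m"
proof -
  note T = two_columnD[OF assms(1)]
  have "m \<in> ran T" using T(4) assms(2) by simp
  then obtain r c where p: "T (r, c) = Some m" by (auto simp: ran_def)
  then have "(0, 0) \<in> dom T" using young_diagramD[OF T(2), of r c] by auto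
  then obtain x where x: "T (0, 0) = Some x" by auto
  then have "m \<le> x" using T(4) ranI[of T, OF x] by auto
  then show ?thesis using monotone_fillingD[OF T(5) x p] x p by fastforce
qed

text \<open>After a closing bracket in row \<open>r\<close> the height is zero iff the first column
  has no entry in row \<open>Suc r\<close>, or a greater one there, which is exactly
  \<open>turns T r\<close>. The path starts from height zero at \<open>m\<close>, so the first
  turning row is the first return, that is, the match of \<open>m\<close>.\<close>

lemma first_turn_iff_arc:
  assumes "two_column {m..n} T" "m \<le> n"
  shows "first_turn T 0 k \<longleftrightarrow> arc (col T 0) (col T 1) m k"
proof -
  note T = two_columnD[OF assms(1)]
  note cols = two_column_cols[OF assms(1)]
  let ?X = "col T 0" and ?Y = "col T 1"
  have m00: "T (0, 0) = Some m" using least_entry_box[OF assms] .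
  then have mX: "m \<in> ?X" by (auto simp: col_def)
  have "{m..n} \<inter> {..<m} = {}" by auto
  then have "?X \<inter> {..<m} = {}" "?Y \<inter> {..<m} = {}" using cols by blast+
  then have hm: "height ?X ?Y m = 0" by (simp add: height_def)
  have arc: "arc ?X ?Y m k" if "first_turn T 0 k" for k
  proof -
    obtain r where r: "T (r, 1) = Some k" "turns T r" and first: "\<And>q. q < r \<Longrightarrow> \<not> turns T q"
      using \<open>first_turn T 0 k\<close> by (auto simp: first_turn_def)
    obtain w where w: "T (r, 0) = Some w" "w < k" using left_entry[OF assms(1) r(1)] .
    have "x \<le> w" if x: "x \<in> ?X" "x \<le> k" for x
    proof -
      obtain s where s: "T (s, 0) = Some x" using x by (auto simp: col_def)
      have "s \<le> r"
      proof (rule ccontr)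
        assume "\<not> s \<le> r"
        then have "(Suc r, 0) \<in> dom T" using young_diagramD[OF T(2) domI[of T, OF s]] by simp
        then obtain y where y: "T (Suc r, 0) = Some y" by auto
        then have "y \<le> x" using col_less_iff(2)[OF T(5) y s] \<open>\<not> s \<le> r\<close> by simp
        then show False using r y x by (auto simp: turns_def)
      qed
      then show ?thesis using col_less_iff(2)[OF T(5) s w(1)] by simp
    qed
    then have "?X \<inter> {..k} = ?X \<inter> {..w}" using w by auto
    then have "height ?X ?Y (Suc k) = 0"
      using card_col_atMost[OF T(5,2) w(1)] card_col_atMost[OF T(5,2) r(1)]
      by (simp add: height_def lessThan_Suc_atMost)
    moreover have "0 < height ?X ?Y x" if x: "m < x" "x \<le> k" for x
    proof (cases "?Y \<inter> {..<x} = {}")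
      case True
      have "m \<in> ?X \<inter> {..<x}" using mX x by auto
      then have "0 < card (?X \<inter> {..<x})" by (auto simp: card_gt_0_iff)
      then show ?thesis using True by (simp add: height_def)
    next
      case False
      then obtain s y where y: "T (s, 1) = Some y" "y < x" "?Y \<inter> {..<x} = ?Y \<inter> {..y}"
        using greatest_below[OF assms(1)] by metis
      have "s < r" using col_less_iff(1)[OF T(5) y(1) r(1)] y x by simp
      \<comment> \<open>Row \<open>s\<close> does not turn, so the opening bracket of the next row
        comes before \<open>y\<close>: at least \<open>s + 2\<close> opening brackets face
        \<open>s + 1\<close> closing ones.\<close>
      then obtain z where z: "T (Suc s, 0) = Some z" "z \<le> y"
        using first[of s] y(1) by (force simp: turns_def)
      have "card (?X \<inter> {..z}) \<le> card (?X \<inter> {..<x})" using z(2) y(2) by (intro card_mono) auto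
      then show ?thesis
        using card_col_atMost[OF T(5,2) z(1)] card_col_atMost[OF T(5,2) y(1)] y(3)
        by (simp add: height_def)
    qed
    moreover have "m < k" using monotone_fillingD[OF T(5) m00 r(1)] by simp
    ultimately show ?thesis using hm by (auto simp: arc_def)
  qed
  moreover have "first_turn T 0 k" if a: "arc ?X ?Y m k"
  proof -
    have "k \<in> ?Y" using arcD(4)[OF a cols(2)] .
    then obtain r where r: "T (r, 1) = Some k" by (auto simp: col_def)
    have cX: "card (?X \<inter> {..k}) = Suc r"
      using arc_end[OF a] card_col_atMost[OF T(5,2) r] hm
      by (simp add: height_def lessThan_Suc_atMost)
    have "k < y" if y: "T (Suc r, 0) = Some y" for y
    proof (rule ccontr)
      assume "\<not> k < y"
      then have "card (?X \<inter> {..y}) \<le> card (?X \<inter> {..k})" by (intro card_mono) auto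
      then show False using cX card_col_atMost[OF T(5,2) y] by simp
    qed
    then have "turns T r" using r by (auto simp: turns_def)
    \<comment> \<open>The row of \<open>k\<close> turns but is not yet known to be the first such
      row. The direction already proved makes the entry in the first one a match of \<open>m\<close>
      too, and the match is unique.\<close>
    define q where "q = (LEAST q. turns T q)"
    have q: "turns T q" "q \<le> r" and least: "\<And>p. turns T p \<Longrightarrow> q \<le> p"
      using \<open>turns T r\<close> by (auto simp: q_def intro: LeastI Least_le)
    obtain l where l: "T (q, 1) = Some l" using q by (auto simp: turns_def)
    have "first_turn T 0 l" using l q least unfolding first_turn_def by (metis le0 not_le)
    then show ?thesis using arc[of l] arc_close_unique[OF a] by simp
  qed
  ultimately show ?thesis by blast
qed

section \<open>Removal of the initial entries\<close>

lemma jdt_remove_least: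
  assumes "two_column {m..n} T" "m \<le> n"
  shows "two_column {Suc m..n} (jdt_remove m T)"
    "col (jdt_remove m T) 1 = col T 1 - {k. arc (col T 0) (col T 1) m k}"
proof -
  note T = two_columnD[OF assms(1)]
  note cols = two_column_cols[OF assms(1)]
  let ?T = "jdt_remove m T"
  have m00: "T (0, 0) = Some m" using least_entry_box[OF assms] .
  have E: "{m..n} - {m} = {Suc m..n}" by auto
  have "young_tableau {Suc m..n} ?T" "dom ?T \<subseteq> dom T"
    using jdt_remove_preserves[OF T(1) m00] by (auto simp: E)
  then show two: "two_column {Suc m..n} ?T" using assms(1) by (auto simp: two_column_def)
  have "(\<exists>r. r \<noteq> 0 \<and> T (r, 0) = Some v) \<longleftrightarrow> v \<in> col T 0 - {m}" for v
    using m00 filling_inj[OF T(5) m00] by (auto simp: col_def) (metis neq0_conv option.inject)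
  then have "col ?T 0 = (col T 0 - {m}) \<union> {k. arc (col T 0) (col T 1) m k}"
    using slide_first_column[OF T(3), of "(0, 0)"] T(2) m00 first_turn_iff_arc[OF assms]
    by (auto simp: jdt_remove_def box_of_eq[OF T(5) m00])
  moreover have "col ?T 1 = {Suc m..n} - col ?T 0" using two_column_cols[OF two] by blast
  moreover have "col T 1 = {m..n} - col T 0" "m \<in> col T 0" using cols m00 by (auto simp: col_def)
  moreover have "{Suc m..n} - ((X - {m}) \<union> A) = {m..n} - X - A" if "m \<in> X" for X A
    using that E by blast
  ultimately show "col ?T 1 = col T 1 - {k. arc (col T 0) (col T 1) m k}" by simp
qed

text \<open>By \<open>arc_truncate\<close> the intermediate tableau has the original arcs from
  \<open>i\<close> on. Hence the next removal takes out of the second column just the original match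
  of \<open>i\<close>, if there is one.\<close>

lemma jdt_remove_initial:
  assumes "two_column {m..n} T" "m \<le> i" "i \<le> n"
  shows "two_column {i..n} (fold jdt_remove [m..<i] T) \<and>
    col (fold jdt_remove [m..<i] T) 1 = {k. \<exists>a\<ge>i. arc (col T 0) (col T 1) a k}"
  using assms(2,3)
proof (induction i rule: dec_induct)
  case base
  have "col T 1 = {k. \<exists>a\<ge>m. arc (col T 0) (col T 1) a k}"
    using ballot_close_matched[OF two_column_ballot[OF assms(1)]]
      arcD(4)[OF _ two_column_cols(2)[OF assms(1)]] by blast
  then show ?case using assms(1) by simp
next
  case (step i)
  let ?A = "arc (col T 0) (col T 1)" and ?U = "fold jdt_remove [m..<i] T"
  have U: "two_column {i..n} ?U" "col ?U 1 = {k. \<exists>a\<ge>i. ?A a k}" using step by auto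
  have "col ?U 0 = {i..n} - col ?U 1" using two_column_cols[OF U(1)] by blast
  then have arc: "arc (col ?U 0) (col ?U 1) i k \<longleftrightarrow> ?A i k" for k
    using arc_truncate[OF two_column_ballot[OF assms(1)] step(1) U(2), of "col ?U 0" i] by simp
  have "(\<exists>a\<ge>i. ?A a k) \<and> \<not> ?A i k \<longleftrightarrow> (\<exists>a\<ge>Suc i. ?A a k)" for k
  proof
    assume "(\<exists>a\<ge>i. ?A a k) \<and> \<not> ?A i k"
    then show "\<exists>a\<ge>Suc i. ?A a k" by (metis Suc_leI le_neq_implies_less)
  next
    assume "\<exists>a\<ge>Suc i. ?A a k"
    then obtain a where a: "Suc i \<le> a" "?A a k" by blast
    have "\<not> ?A i k" using arc_open_unique[OF a(2), of i] a(1) by auto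
    then show "(\<exists>a\<ge>i. ?A a k) \<and> \<not> ?A i k" using a Suc_leD by blast
  qed
  then have "col ?U 1 - {k. ?A i k} = {k. \<exists>a\<ge>Suc i. ?A a k}" unfolding U(2) by blast
  then have "col ?U 1 - {k. arc (col ?U 0) (col ?U 1) i k} = {k. \<exists>a\<ge>Suc i. ?A a k}"
    by (simp only: arc)
  moreover have "fold jdt_remove [m..<Suc i] T = jdt_remove i ?U" using step(1) by simp
  ultimately show ?case using jdt_remove_least[OF U(1)] step(4) by (simp only:)
qed

lemma jdt_remove_list:
  assumes "young_tableau E T" "distinct as" "set as \<subseteq> E"
  shows "young_tableau (E - set as) (fold jdt_remove as T) \<and> dom (fold jdt_remove as T) \<subseteq> dom T \<and>
    (\<forall>q x. T q = Some x \<and> (\<forall>a\<in>set as. x < a) \<longrightarrow> fold jdt_remove as T q = Some x)"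
  using assms
proof (induction as arbitrary: E T)
  case (Cons a as)
  have "a \<in> ran T" using Cons.prems by (auto simp: young_tableau_def)
  then obtain p where p: "T p = Some a" by (auto simp: ran_def)
  note r = jdt_remove_preserves[OF Cons.prems(1) p]
  have "set as \<subseteq> E - {a}" using Cons.prems by auto
  note IH = Cons.IH[OF r(1) _ this]
  have "E - set (a # as) = E - {a} - set as" by auto
  moreover have "distinct as" using Cons.prems by simp
  moreover have "jdt_remove a T q = Some x" if "T q = Some x" "\<forall>b\<in>set (a # as). x < b" for q x
    using r(3)[OF that(1)] that(2) by simp
  ultimately show ?case using IH subset_trans[OF _ r(2)] by simp
qed simp

text \<open>The second column determines the first as its complement, and the row of an entry is its
  rank in its column.\<close>

lemma two_column_eqI:
  assumes "two_column E T" "two_column E S" "col T 1 = col S 1"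
  shows "T = S"
proof -
  note T = two_columnD[OF assms(1)] and S = two_columnD[OF assms(2)]
  have "col T c = col S c" for c
  proof -
    have "col T 0 = col S 0"
      using two_column_cols[OF assms(1)] two_column_cols[OF assms(2)] assms(3) by blast
    moreover have "col T c = {}" "col S c = {}" if "\<not> c < 2"
      using T(7)[of "(_, c)"] S(7)[of "(_, c)"] that by (auto simp: col_def)
    moreover have "c = 0 \<or> c = 1 \<or> \<not> c < 2" by auto
    ultimately show ?thesis using assms(3) by auto
  qed
  note cols = this
  have "T (r, c) = Some x \<longleftrightarrow> S (r, c) = Some x" for r c x
  proof -
    have "S (r, c) = Some x" if "young_diagram (dom T)" "monotone_filling T"
      "young_diagram (dom S)" "monotone_filling S" "col T c = col S c" "T (r, c) = Some x"
      for T S :: tableau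
    proof -
      have "x \<in> col S c" using that by (auto simp: col_def)
      then obtain s where s: "S (s, c) = Some x" by (auto simp: col_def)
      then show ?thesis using card_col_atMost[OF that(2,1,6)] card_col_atMost[OF that(4,3) s] that(5)
        by simp
    qed
    then show ?thesis using T S cols by metis
  qed
  then have "T p = S p" for p by (cases p) (metis option.exhaust)
  then show ?thesis by blast
qed

section \<open>Ascents of the word\<close>

lemma delete_greatest_ascent_first:
  assumes "\<And>v. v \<in> X \<union> Y \<Longrightarrow> v \<le> z" "z \<notin> Y" "a \<noteq> z"
  shows "ascent (X - {z}) Y a c \<longleftrightarrow> ascent X Y a c"
proof
  assume "ascent X Y a c"
  then obtain j where j: "a \<in> X" "c \<in> Y" "a < c" "c \<le> j" "card (X \<inter> {a..j}) \<le> card (Y \<inter> {c..j})"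
    by (auto simp: ascent_def)
  have "card ((X - {z}) \<inter> {a..j}) \<le> card (X \<inter> {a..j})" by (intro card_mono) auto
  then show "ascent (X - {z}) Y a c" using j assms(3) by (fastforce simp: ascent_def)
next
  assume "ascent (X - {z}) Y a c"
  then obtain j where j: "a \<in> X" "c \<in> Y" "a < c" "c \<le> j"
    "card ((X - {z}) \<inter> {a..j}) \<le> card (Y \<inter> {c..j})"
    by (auto simp: ascent_def)
  have "c < z" using j(2) assms(1)[of c] assms(2) by (cases "c = z") auto
  \<comment> \<open>Below \<open>z\<close> both sets of opening brackets agree, and all closing
    brackets are below \<open>z\<close>, so the cap loses none of them.\<close>
  define i where "i = min j (z - 1)"
  have "X \<inter> {a..i} \<subseteq> (X - {z}) \<inter> {a..j}" using \<open>c < z\<close> by (auto simp: i_def)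
  then have "card (X \<inter> {a..i}) \<le> card ((X - {z}) \<inter> {a..j})" by (intro card_mono) auto
  moreover have "y \<le> i" if "y \<in> Y" "y \<le> j" for y
    using that assms(1)[of y] assms(2) by (cases "y = z") (auto simp: i_def)
  then have "Y \<inter> {c..j} \<subseteq> Y \<inter> {c..i}" by auto
  then have "card (Y \<inter> {c..j}) \<le> card (Y \<inter> {c..i})" by (intro card_mono) auto
  moreover have "c \<le> i" using j \<open>c < z\<close> by (auto simp: i_def)
  ultimately show "ascent X Y a c" using j unfolding ascent_def by (meson le_trans)
qed

text \<open>The letter \<open>b\<close> comes first in the word, which accounts for the new pairs.
  For the others the opening bracket \<open>b\<close> and the closing bracket \<open>z\<close>
  disappear together, so a witness only has to be moved across \<open>z\<close>.\<close>

lemma delete_greatest_ascent_second: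
  assumes greatest: "\<And>v. v \<in> X \<union> Y \<Longrightarrow> v \<le> z" and "z \<in> Y" "z \<notin> X"
    and b: "b \<in> X" "\<And>x. x \<in> X \<Longrightarrow> x \<le> b" "b < z"
  shows "ascent X Y a c \<longleftrightarrow>
    (a = b \<and> c \<in> Y \<and> b < c) \<or> ascent (insert z (X - {b})) (Y - {z}) a c"
proof -
  let ?X = "insert z (X - {b})" and ?Y = "Y - {z}"
  have "ascent ?X ?Y a c" if asc: "ascent X Y a c" and "a \<noteq> b"
  proof -
    obtain j where j: "a \<in> X" "c \<in> Y" "a < c" "c \<le> j" "card (X \<inter> {a..j}) \<le> card (Y \<inter> {c..j})"
      using asc by (auto simp: ascent_def)
    have "a < b" using b(2)[OF j(1)] \<open>a \<noteq> b\<close> by simp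
    \<comment> \<open>From \<open>z\<close> on there is a single closing bracket, against the two
      opening brackets \<open>a\<close> and \<open>b\<close>.\<close>
    have "c \<noteq> z"
    proof
      assume "c = z"
      then have "Y \<inter> {c..j} \<subseteq> {z}" using greatest by fastforce
      then have "card (Y \<inter> {c..j}) \<le> 1" using card_mono[of "{z}"] by fastforce
      moreover have "{a, b} \<subseteq> X \<inter> {a..j}" using j b \<open>a < b\<close> \<open>c = z\<close> by auto
      then have "card {a, b} \<le> card (X \<inter> {a..j})" by (intro card_mono) auto
      ultimately show False using j(5) \<open>a < b\<close> by simp
    qed
    then have "c < z" using greatest[of c] j(2) by auto
    \<comment> \<open>The cap keeps the new opening bracket \<open>z\<close> out of the count. If it
      drops the closing bracket \<open>z\<close>, the absence of \<open>b\<close> compensates for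
      it.\<close>
    define i where "i = min j (z - 1)"
    have "c \<le> i" using j \<open>c < z\<close> by (auto simp: i_def)
    moreover have "card (?X \<inter> {a..i}) \<le> card (?Y \<inter> {c..i})"
    proof (cases "j < z")
      case True
      then have "i = j" by (auto simp: i_def)
      have "?X \<inter> {a..j} \<subseteq> X \<inter> {a..j}" using True by auto
      then have "card (?X \<inter> {a..j}) \<le> card (X \<inter> {a..j})" by (intro card_mono) auto
      moreover have "?Y \<inter> {c..j} = Y \<inter> {c..j}" using True by auto
      ultimately show ?thesis using j(5) by (simp add: \<open>i = j\<close>)
    next
      case False
      then have "i = z - 1" by (auto simp: i_def)
      have "?X \<inter> {a..i} \<subseteq> (X \<inter> {a..j}) - {b}" using False \<open>c < z\<close> by (auto simp: \<open>i = z - 1\<close>)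
      then have "card (?X \<inter> {a..i}) \<le> card (X \<inter> {a..j} - {b})" by (intro card_mono) auto
      also have "\<dots> = card (X \<inter> {a..j}) - 1" using b \<open>a < b\<close> False by (intro card_Diff_singleton) auto
      also have "\<dots> \<le> card (Y \<inter> {c..j}) - 1" using j(5) by simp
      also have "\<dots> = card (Y \<inter> {c..j} - {z})"
        using \<open>z \<in> Y\<close> False \<open>c < z\<close> by (intro card_Diff_singleton[symmetric]) auto
      also have "y \<le> i" if "y \<in> Y" "y \<noteq> z" for y
        using that greatest[of y] by (auto simp: \<open>i = z - 1\<close>)
      then have "Y \<inter> {c..j} - {z} \<subseteq> ?Y \<inter> {c..i}" by force
      then have "card (Y \<inter> {c..j} - {z}) \<le> card (?Y \<inter> {c..i})" by (intro card_mono) auto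
      finally show ?thesis .
    qed
    ultimately show ?thesis using j \<open>a \<noteq> b\<close> \<open>c \<noteq> z\<close> unfolding ascent_def by blast
  qed
  moreover have "ascent X Y a c" if "a = b" "c \<in> Y" "b < c"
  proof -
    have "X \<inter> {b..c} \<subseteq> {b}" using b(2) by force
    then have "card (X \<inter> {b..c}) \<le> 1" using card_mono[of "{b}"] by fastforce
    moreover have "Y \<inter> {c..c} = {c}" using that by auto
    ultimately show ?thesis using that b unfolding ascent_def by (intro conjI exI[of _ c]) auto
  qed
  moreover have "ascent X Y a c" if asc: "ascent ?X ?Y a c"
  proof -
    obtain j where j: "a \<in> ?X" "c \<in> ?Y" "a < c" "c \<le> j" "card (?X \<inter> {a..j}) \<le> card (?Y \<inter> {c..j})"
      using asc by (auto simp: ascent_def)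
    have "c < z" using greatest[of c] j(2) by auto
    then have "a \<in> X" "a \<noteq> b" using j by auto
    have "\<exists>i\<ge>c. card (X \<inter> {a..i}) \<le> card (Y \<inter> {c..i})"
    proof (cases "j < b")
      case True
      have "X \<inter> {a..j} \<subseteq> ?X \<inter> {a..j}" "?Y \<inter> {c..j} \<subseteq> Y \<inter> {c..j}" using True by auto
      then have "card (X \<inter> {a..j}) \<le> card (?X \<inter> {a..j})" "card (?Y \<inter> {c..j}) \<le> card (Y \<inter> {c..j})"
        by (auto intro!: card_mono)
      then show ?thesis using j(4,5) by (intro exI[of _ j]) auto
    next
      case False
      \<comment> \<open>The witness moves up to \<open>z\<close>: the opening brackets gain at most
        \<open>b\<close>, while the closing ones gain \<open>z\<close>.\<close>
      have "x \<le> j" if "x \<in> X" for x using b(2)[OF that] False by auto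
      then have "X \<inter> {a..z} \<subseteq> insert b (?X \<inter> {a..j})" by auto
      then have "card (X \<inter> {a..z}) \<le> card (insert b (?X \<inter> {a..j}))" by (intro card_mono) auto
      also have "\<dots> \<le> Suc (card (?X \<inter> {a..j}))" by (rule card_insert_le_m1) auto
      also have "\<dots> \<le> Suc (card (?Y \<inter> {c..j}))" using j(5) by simp
      also have "\<dots> = card (insert z (?Y \<inter> {c..j}))" by simp
      also have "insert z (?Y \<inter> {c..j}) \<subseteq> Y \<inter> {c..z}" using \<open>z \<in> Y\<close> \<open>c < z\<close> greatest by auto
      then have "card (insert z (?Y \<inter> {c..j})) \<le> card (Y \<inter> {c..z})" by (intro card_mono) auto
      finally show ?thesis using \<open>c < z\<close> by (intro exI[of _ z]) auto
    qed
    then show ?thesis using j \<open>a \<in> X\<close> unfolding ascent_def by blast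
  qed
  moreover have "c \<in> Y \<and> a < c" if "ascent X Y a c" using that by (simp add: ascent_def)
  ultimately show ?thesis by blast
qed

section \<open>Positions of letters\<close>

lemma position_nth:
  assumes "distinct w" "k < length w"
  shows "position w (w ! k) = k"
  unfolding position_def
  by (rule the_equality) (use assms nth_eq_iff_index_eq in blast)+

lemma position_Cons:
  assumes "distinct (x # w)"
  shows "position (x # w) x = 0" "a \<in> set w \<Longrightarrow> position (x # w) a = Suc (position w a)"
proof -
  show "position (x # w) x = 0" using position_nth[OF assms, of 0] by simp
  assume "a \<in> set w"
  then obtain k where "k < length w" "w ! k = a" by (auto simp: in_set_conv_nth)
  then show "position (x # w) a = Suc (position w a)"
    using position_nth[OF assms, of "Suc k"] position_nth[of w k] assms by auto
qed

lemma card_dom_two_column: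
  assumes "two_column E T"
  shows "card (dom T) = card E"
proof -
  note T = two_columnD[OF assms]
  have "bij_betw (\<lambda>p. the (T p)) (dom T) E"
  proof (rule bij_betwI')
    fix p q assume "p \<in> dom T" "q \<in> dom T"
    then obtain v w where "T p = Some v" "T q = Some w" by blast
    then show "the (T p) = the (T q) \<longleftrightarrow> p = q" using filling_inj[OF T(5), of p v q] by auto
  next
    fix v assume "v \<in> E"
    then obtain p where "T p = Some v" using T(4) by (auto simp: ran_def)
    then show "\<exists>p\<in>dom T. v = the (T p)" by (intro bexI[of _ p]) auto
  next
    fix p assume "p \<in> dom T"
    then show "the (T p) \<in> E" using T(4) by (auto intro: ranI)
  qed
  then show ?thesis by (rule bij_betw_same_card)
qed

section \<open>Deletion of the greatest entry\<close>

lemma greatest_is_corner: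
  assumes "two_column E T" "T p = Some z" "\<And>v. v \<in> E \<Longrightarrow> v \<le> z"
    and "q \<in> dom T" "fst p \<le> fst q" "snd p \<le> snd q"
  shows "q = p"
proof (rule ccontr)
  note T = two_columnD[OF assms(1)]
  assume "q \<noteq> p"
  moreover obtain y where y: "T q = Some y" using assms(4) by auto
  ultimately have "z < y" using monotone_fillingD[OF T(5) assms(2) y] assms by auto
  moreover have "y \<in> E" using y T(4) by (auto intro: ranI)
  ultimately show False using assms(3)[of y] by simp
qed

lemma two_columnI:
  assumes "0 \<notin> E" "young_diagram (dom T)" "monotone_filling T" "ran T = E"
    and "\<And>p. p \<in> dom T \<Longrightarrow> snd p < 2"
  shows "two_column E T"
  using assms by (auto simp: two_column_def young_tableau_iff_monotone_filling)

lemma delete_greatest_first: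
  assumes U: "two_column E U" and z: "z \<in> col U 0" and greatest: "\<And>v. v \<in> E \<Longrightarrow> v \<le> z"
  shows "expelled U z = z" "two_column (E - {z}) (delete_corner U z)"
    "col (delete_corner U z) 0 = col U 0 - {z}" "col (delete_corner U z) 1 = col U 1"
proof -
  note T = two_columnD[OF U]
  obtain r where r: "U (r, 0) = Some z" using z by (auto simp: col_def)
  have box: "box_of U z = (r, 0)" using box_of_eq[OF T(5) r] .
  show "expelled U z = z" by (simp add: expelled_def box)
  have V: "delete_corner U z = U((r, 0) := None)" by (simp add: delete_corner_def box)
  let ?V = "U((r, 0) := None)"
  have V_iff: "?V p = Some v \<longleftrightarrow> U p = Some v \<and> v \<noteq> z" for p v
  proof -
    have "U p = Some z \<longleftrightarrow> p = (r, 0)" using filling_inj[OF T(5) r, of p] r by metis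
    then show ?thesis by (cases "p = (r, 0)") auto
  qed
  show "two_column (E - {z}) (delete_corner U z)"
    unfolding V
  proof (rule two_columnI)
    have "young_diagram (dom U - {(r, 0)})"
      using young_diagram_remove[OF T(2)] greatest_is_corner[OF U r greatest] by blast
    then show "young_diagram (dom ?V)" by simp
    show "monotone_filling ?V"
      unfolding monotone_filling_def inj_on_def
    proof (intro conjI ballI allI impI)
      fix p q assume pq: "p \<in> dom ?V" "q \<in> dom ?V" "?V p = ?V q"
      then obtain v where "?V p = Some v" "?V q = Some v" by (metis domD)
      then show "p = q" using filling_inj[OF T(5)] V_iff by blast
    next
      fix p q x y
      assume "?V p = Some x \<and> ?V q = Some y \<and> fst p \<le> fst q \<and> snd p \<le> snd q \<and> p \<noteq> q"
      then show "x < y" using monotone_fillingD[OF T(5)] V_iff by blast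
    qed
    show "ran ?V = E - {z}" using V_iff T(4) by (auto simp: ran_def simp del: fun_upd_apply)
    show "0 \<notin> E - {z}" using T(1) by (auto simp: young_tableau_def)
    show "snd p < 2" if "p \<in> dom ?V" for p using that T(7) V_iff by blast
  qed
  show "col (delete_corner U z) 0 = col U 0 - {z}"
    unfolding V col_def V_iff by blast
  have "U (s, 1) \<noteq> Some z" for s using filling_inj[OF T(5) r, of "(s, 1)"] by auto
  then show "col (delete_corner U z) 1 = col U 1"
    unfolding V col_def V_iff by blast
qed

text \<open>All entries of the first column are smaller than \<open>z\<close>, so \<open>b\<close>
  is its last entry, and \<open>z\<close> may replace it once the box of \<open>z\<close> has been
  vacated.\<close>

lemma delete_greatest_second:
  assumes U: "two_column E U" and z: "z \<in> col U 1" and greatest: "\<And>v. v \<in> E \<Longrightarrow> v \<le> z"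
    and b: "b = expelled U z"
  shows "b \<in> col U 0" "b < z" "\<And>x. x \<in> col U 0 \<Longrightarrow> x \<le> b"
    "two_column (E - {b}) (delete_corner U z)"
    "col (delete_corner U z) 0 = insert z (col U 0 - {b})"
    "col (delete_corner U z) 1 = col U 1 - {z}"
proof -
  note T = two_columnD[OF U] and cols = two_column_cols[OF U]
  obtain r where r: "U (r, 1) = Some z" using z by (auto simp: col_def)
  have box: "box_of U z = (r, 1)" using box_of_eq[OF T(5) r] .
  have lt: "x < z" if "x \<in> col U 0" for x
    using that greatest[of x] cols z by (cases "x = z") auto
  then have "{b. b < z \<and> (\<exists>r. U (r, 0) = Some b)} = col U 0" by (auto simp: col_def)
  then have bMax: "b = Max (col U 0)" by (simp add: b expelled_def box)
  obtain w where w: "U (r, 0) = Some w" using left_entry[OF U r] by blast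
  then have "col U 0 \<noteq> {}" by (auto simp: col_def)
  then show bX: "b \<in> col U 0" using finite_col[OF U] by (simp add: bMax)
  show bmax: "x \<le> b" if "x \<in> col U 0" for x using that finite_col[OF U] by (simp add: bMax)
  show bz: "b < z" using lt bX .
  obtain s where s: "U (s, 0) = Some b" using bX by (auto simp: col_def)
  have boxb: "box_of U (expelled U z) = (s, 0)" using box_of_eq[OF T(5) s] b by simp
  let ?V = "U((r, 1) := None, (s, 0) := Some z)"
  have V: "delete_corner U z = ?V" by (simp add: delete_corner_def box boxb)
  have V_iff: "?V p = Some v \<longleftrightarrow> p = (s, 0) \<and> v = z \<or> U p = Some v \<and> v \<noteq> z \<and> v \<noteq> b" for p v
  proof -
    have "U p = Some z \<longleftrightarrow> p = (r, 1)" using filling_inj[OF T(5) r, of p] r by metis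
    moreover have "U p = Some b \<longleftrightarrow> p = (s, 0)" using filling_inj[OF T(5) s, of p] s by metis
    ultimately show ?thesis using bz by (cases "p = (s, 0)"; cases "p = (r, 1)") auto
  qed
  have rs: "t \<le> s" if "(t, c) \<in> dom U" for t c
  proof -
    have "(t, 0) \<in> dom U" using young_diagramD[OF T(2) that] by simp
    then obtain x where x: "U (t, 0) = Some x" by auto
    then have "x \<le> b" using bmax by (auto simp: col_def)
    then show ?thesis using col_less_iff(2)[OF T(5) x s] by simp
  qed
  have r_last: "t \<le> r" if "(t, 1) \<in> dom U" for t
    using greatest_is_corner[OF U r greatest that] by (cases "r \<le> t") auto
  \<comment> \<open>Row \<open>s\<close> is the last row. A right neighbour of \<open>(s, 0)\<close>
    would be the last box of the second column, hence the box that \<open>z\<close> has just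
    left.\<close>
  have s_corner: "q = (s, 0)" if "?V q = Some y" "s \<le> fst q" for q y
  proof (rule ccontr)
    assume "q \<noteq> (s, 0)"
    then have q: "U q = Some y" "y \<noteq> z" using that V_iff by blast+
    obtain t c where tc: "q = (t, c)" by (cases q)
    have "t = s" using rs[of t c] q that tc by auto
    then have "c = 1" using T(7)[OF q(1)] \<open>q \<noteq> (s, 0)\<close> tc by auto
    then have "s \<le> r" using r_last[of s] q tc \<open>t = s\<close> by auto
    moreover have "r \<le> s" using rs[of r 1] r by auto
    ultimately show False using q r tc \<open>t = s\<close> \<open>c = 1\<close> by simp
  qed
  show "two_column (E - {b}) (delete_corner U z)"
    unfolding V
  proof (rule two_columnI)
    have "young_diagram (dom U - {(r, 1)})"
      using young_diagram_remove[OF T(2)] greatest_is_corner[OF U r greatest] by blast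
    moreover have "dom ?V = dom U - {(r, 1)}" using s by auto
    ultimately show "young_diagram (dom ?V)" by simp
    show "monotone_filling ?V"
      unfolding monotone_filling_def inj_on_def
    proof (intro conjI ballI allI impI)
      fix p q assume pq: "p \<in> dom ?V" "q \<in> dom ?V" "?V p = ?V q"
      then obtain v where "?V p = Some v" "?V q = Some v" by (metis domD)
      then show "p = q" using filling_inj[OF T(5), of p v q] unfolding V_iff by metis
    next
      fix p q x y
      assume a: "?V p = Some x \<and> ?V q = Some y \<and> fst p \<le> fst q \<and> snd p \<le> snd q \<and> p \<noteq> q"
      have "p \<noteq> (s, 0)"
      proof
        assume p: "p = (s, 0)"
        have q: "?V q = Some y" "fst p \<le> fst q" "p \<noteq> q" using a by blast+
        then have "s \<le> fst q" using p by simp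
        then show False using s_corner[OF q(1)] p q(3) by blast
      qed
      then have p: "U p = Some x" "x \<noteq> z" using a V_iff[of p x] by blast+
      then have "x \<in> E" using T(4) by (auto intro: ranI)
      then have "x < z" using greatest[of x] p(2) by simp
      show "x < y"
      proof (cases "q = (s, 0)")
        case True
        then have "y = z" using a by simp
        then show ?thesis using \<open>x < z\<close> by simp
      next
        case False
        then have "U q = Some y" using a V_iff[of q y] by blast
        then show ?thesis using monotone_fillingD[OF T(5) p(1)] a by blast
      qed
    qed
    have "v \<in> ran ?V \<longleftrightarrow> v \<in> E - {b}" for v
    proof -
      have "v \<in> ran ?V \<longleftrightarrow> v = z \<or> (v \<in> ran U \<and> v \<noteq> z \<and> v \<noteq> b)"
        unfolding ran_def mem_Collect_eq V_iff by blast
      moreover have "z \<in> E" "z \<noteq> b" using z cols bz by auto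
      ultimately show ?thesis using T(4) by blast
    qed
    then show "ran ?V = E - {b}" by blast
    show "0 \<notin> E - {b}" using T(1) by (auto simp: young_tableau_def)
    show "snd p < 2" if p: "p \<in> dom ?V" for p
    proof -
      obtain v where "?V p = Some v" using domD[OF p] by blast
      then have "p = (s, 0) \<or> U p = Some v" using V_iff[of p v] by blast
      then show ?thesis using T(7)[of p v] by auto
    qed
  qed
  show "col (delete_corner U z) 0 = insert z (col U 0 - {b})"
    unfolding V col_def V_iff using lt by (auto simp: col_def)
  show "col (delete_corner U z) 1 = col U 1 - {z}"
    unfolding V col_def V_iff using bX cols(2) by (auto simp: col_def)
qed

text \<open>The first letter \<open>e\<close> precedes every other letter, so passing from the rest
  of the word to the whole must add exactly the ascents \<open>(e, c)\<close> with \<open>c\<close>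
  in \<open>E\<close> and \<open>e < c\<close>. If \<open>z\<close> opens, then \<open>e = z\<close>
  and there are none.\<close>

lemma word_aux_ascents:
  assumes "two_column E U" "card E = i"
  shows "distinct (word_aux i U) \<and> set (word_aux i U) = E \<and>
    (\<forall>a\<in>E. \<forall>c\<in>E. a < c \<longrightarrow>
      (position (word_aux i U) a < position (word_aux i U) c \<longleftrightarrow> ascent (col U 0) (col U 1) a c))"
  using assms
proof (induction i arbitrary: U E)
  case 0
  then show ?case using two_columnD(6)[of E U] by simp
next
  case (Suc i)
  note T = two_columnD[OF Suc.prems(1)] and cols = two_column_cols[OF Suc.prems(1)]
  define z where "z = Max E"
  define e where "e = expelled U z"
  let ?V = "delete_corner U z" and ?X = "col U 0" and ?Y = "col U 1"
  let ?w = "word_aux i ?V"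
  have "E \<noteq> {}" using Suc.prems(2) by auto
  then have zE: "z \<in> E" and greatest: "\<And>v. v \<in> E \<Longrightarrow> v \<le> z" using T(6) by (auto simp: z_def)
  have word: "word_aux (Suc i) U = e # ?w" using T(4) by (simp add: z_def e_def Let_def)
  have step: "e \<in> E \<and> two_column (E - {e}) ?V \<and>
    (\<forall>a c. a < c \<longrightarrow> (ascent ?X ?Y a c \<longleftrightarrow> c \<in> E \<and> a = e \<or> ascent (col ?V 0) (col ?V 1) a c))"
  proof (cases "z \<in> ?X")
    case True
    note d = delete_greatest_first[OF Suc.prems(1) True greatest]
    have "z \<notin> ?Y" using True cols(2) by blast
    have "ascent ?X ?Y a c \<longleftrightarrow> c \<in> E \<and> a = e \<or> ascent (col ?V 0) (col ?V 1) a c" if "a < c" for a c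
    proof (cases "a = z")
      case True
      then have "c \<notin> E" using greatest[of c] that by auto
      then have "c \<notin> ?Y" using cols by blast
      then show ?thesis using \<open>c \<notin> E\<close> d(4) by (simp add: ascent_def)
    next
      case False
      have le: "v \<le> z" if "v \<in> ?X \<union> ?Y" for v using that greatest cols(1) by blast
      show ?thesis
        using delete_greatest_ascent_first[OF le \<open>z \<notin> ?Y\<close> False] d False by (simp add: e_def)
    qed
    then show ?thesis using d zE by (simp add: e_def)
  next
    case False
    then have zY: "z \<in> ?Y" using zE cols by blast
    note d = delete_greatest_second[OF Suc.prems(1) zY greatest e_def]
    have le: "v \<le> z" if "v \<in> ?X \<union> ?Y" for v using that greatest cols(1) by blast
    \<comment> \<open>Here \<open>e\<close> is the greatest opening bracket, so every greater entry
      is a closing one.\<close>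
    have "c \<in> ?Y \<longleftrightarrow> c \<in> E" if "e < c" for c using d(3)[of c] that cols by force
    then have "ascent ?X ?Y a c \<longleftrightarrow> c \<in> E \<and> a = e \<or> ascent (col ?V 0) (col ?V 1) a c" if "a < c" for a c
      using delete_greatest_ascent_second[OF le zY False d(1,3,2)] d(5,6) that by auto
    then show ?thesis using d(1,4) cols by blast
  qed
  have "card (E - {e}) = i" using Suc.prems(2) step T(6) by simp
  then have IH: "distinct ?w" "set ?w = E - {e}" "\<And>a c. a \<in> E - {e} \<Longrightarrow> c \<in> E - {e} \<Longrightarrow> a < c \<Longrightarrow>
      position ?w a < position ?w c \<longleftrightarrow> ascent (col ?V 0) (col ?V 1) a c"
    using Suc.IH[of "E - {e}" ?V] step by auto
  have dist: "distinct (e # ?w)" using IH by simp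
  have "position (e # ?w) a < position (e # ?w) c \<longleftrightarrow> ascent ?X ?Y a c"
    if ac: "a \<in> E" "c \<in> E" "a < c" for a c
  proof -
    have no_e: "\<not> ascent (col ?V 0) (col ?V 1) a e"
      using two_column_cols[of "E - {e}" ?V] step by (auto simp: ascent_def)
    consider "a = e" | "c = e" "a \<noteq> e" | "a \<in> E - {e}" "c \<in> E - {e}" using ac by blast
    then show ?thesis
    proof cases
      case 1
      then have "c \<in> set ?w" using ac IH(2) by auto
      then show ?thesis using 1 position_Cons[OF dist] ac step by simp
    next
      case 2
      then show ?thesis using position_Cons(1)[OF dist] no_e ac step by auto
    next
      case 3
      then have "a \<in> set ?w" "c \<in> set ?w" using IH(2) by auto
      then show ?thesis using position_Cons(2)[OF dist] IH(3)[OF 3 ac(3)] 3 ac step by auto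
    qed
  qed
  then show ?case unfolding word using IH step by auto
qed

section \<open>The two orders\<close>

lemma two_column_tableaux_iff: "T \<in> two_column_tableaux n \<longleftrightarrow> two_column {1..n} T"
  by (auto simp: two_column_tableaux_def two_column_def standard_tableau_def case_prod_beta)

text \<open>Entries up to \<open>j\<close> stay in place when the greater ones are removed, so this
  second stage merely cuts the second column off at \<open>j\<close>.\<close>

lemma cols_projection:
  assumes T: "two_column {1..n} T" and ij: "1 \<le> i" "i < j" "j \<le> n"
  shows "two_column {i..j} (projection i j T)"
    "col (projection i j T) 1 = arcs_within (col T 0) (col T 1) i j"
proof -
  define U where "U = fold jdt_remove [1..<i] T"
  define P where "P = fold jdt_remove [Suc j..<Suc n] U"
  have "sorted_list_of_set (ran T) = [1..<Suc n]"
    using two_columnD(4)[OF T] by (simp add: atLeastLessThanSuc_atLeastAtMost[symmetric] del: upt_Suc)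
  then have proj: "projection i j T = P"
    using ij by (simp add: projection_def P_def U_def take_upt drop_upt del: upt_Suc)
  have U: "two_column {i..n} U" "col U 1 = {k. \<exists>a\<ge>i. arc (col T 0) (col T 1) a k}"
    using jdt_remove_initial[OF T ij(1)] ij by (simp_all add: U_def)
  have E: "{i..n} - set [Suc j..<Suc n] = {i..j}" "set [Suc j..<Suc n] \<subseteq> {i..n}"
    using ij by auto
  note r = jdt_remove_list[OF two_columnD(1)[OF U(1)] distinct_upt E(2)]
  have P: "young_tableau {i..j} P" "dom P \<subseteq> dom U"
    using r unfolding E(1) P_def by blast+
  have keep: "P q = Some x" if "U q = Some x" "x \<le> j" for q x
  proof -
    have "\<forall>a\<in>set [Suc j..<Suc n]. x < a" using that(2) by auto
    then show ?thesis using r that(1) unfolding P_def by blast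
  qed
  show two: "two_column {i..j} (projection i j T)"
    using P U(1) by (auto simp: two_column_def proj)
  have "P q = Some x \<longleftrightarrow> U q = Some x \<and> x \<le> j" for q x
  proof
    assume q: "P q = Some x"
    then have "x \<in> {i..j}" using P(1) by (auto simp: young_tableau_def intro: ranI)
    then have "x \<in> ran U" using two_columnD(4)[OF U(1)] ij by auto
    then obtain p where p: "U p = Some x" by (auto simp: ran_def)
    then have "P p = Some x" using keep \<open>x \<in> {i..j}\<close> by simp
    moreover have "monotone_filling P" using P(1) by (simp add: young_tableau_iff_monotone_filling)
    ultimately have "p = q" using filling_inj q by blast
    then show "U q = Some x \<and> x \<le> j" using p \<open>x \<in> {i..j}\<close> by simp
  qed (use keep in blast)
  then have "col P 1 = col U 1 \<inter> {..j}" unfolding col_def by auto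
  then show "col (projection i j T) 1 = arcs_within (col T 0) (col T 1) i j"
    unfolding proj U(2) arcs_within_def by auto
qed

lemma shape_two_column:
  assumes "two_column E T" "E \<noteq> {}"
  shows "shape T = (if card (col T 1) = 0 then [card (col T 0)] else [card (col T 0), card (col T 1)])"
proof -
  note T = two_columnD[OF assms(1)]
  obtain r c v where v: "T (r, c) = Some v" using assms(2) T(4) by (auto simp: ran_def)
  have "(0, 0) \<in> dom T" using young_diagramD[OF T(2) domI[of T, OF v]] by simp
  moreover have "(0, 1) \<in> dom T \<longleftrightarrow> col T 1 \<noteq> {}"
    using young_diagramD[OF T(2), of _ 1 0 1] by (fastforce simp: col_def)
  moreover have "c < 2" if "(0, c) \<in> dom T" for c using T(7)[of "(0, c)"] that by auto
  ultimately have "{c. (0, c) \<in> dom T} = (if card (col T 1) = 0 then {0} else {0, 1})"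
    using finite_col[OF assms(1), of 1] by (auto simp: less_2_cases_iff)
  then show ?thesis
    by (simp add: shape_def column_length_eq_card_col[OF T(5)] upt_rec numeral_2_eq_2)
qed

text \<open>Both shapes have the same total, so only the first columns matter, and a longer first
  column means a shorter second one.\<close>

lemma dominance_le_two_column:
  assumes "two_column E T" "two_column E S" "E \<noteq> {}"
  shows "dominance_le (shape T) (shape S) \<longleftrightarrow> card (col S 1) \<le> card (col T 1)"
proof -
  have sum: "card (col U 0) + card (col U 1) = card E" if "two_column E U" for U
    using two_column_cols[OF that] finite_col[OF that] card_Un_disjoint by metis
  have dom: "dominance_le m l \<longleftrightarrow>
      (\<forall>i\<le>min (length m) (length l). sum_list (take i m) \<le> sum_list (take i l))" for m l
    by (auto simp: dominance_le_def)
  show ?thesis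
    using sum[OF assms(1)] sum[OF assms(2)]
    unfolding dom shape_two_column[OF assms(1,3)] shape_two_column[OF assms(2,3)]
    by (auto simp: numeral_2_eq_2 le_Suc_eq all_conj_distrib)
qed

lemma chain_le_iff_arcs:
  assumes T: "two_column {1..n} T" and S: "two_column {1..n} S"
  shows "chain_le T S \<longleftrightarrow>
    (\<forall>a k. arc (col S 0) (col S 1) a k \<longrightarrow> arc (col T 0) (col T 1) a k)"
proof -
  let ?t = "arcs_within (col T 0) (col T 1)" and ?s = "arcs_within (col S 0) (col S 1)"
  have ran: "ran T = {1..n}" "ran S = {1..n}"
    using two_columnD(4)[OF T] two_columnD(4)[OF S] by auto
  have dom: "dominance_le (shape (projection i j T)) (shape (projection i j S)) \<longleftrightarrow>
    card (?s i j) \<le> card (?t i j)" if "1 \<le> i" "i < j" "j \<le> n" for i j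
    using dominance_le_two_column[OF cols_projection(1)[OF T that] cols_projection(1)[OF S that]]
      cols_projection(2)[OF T that] cols_projection(2)[OF S that] that by simp
  have chain: "chain_le T S \<longleftrightarrow>
    (\<forall>i j. 1 \<le> i \<and> i < j \<and> j \<le> n \<longrightarrow> card (?s i j) \<le> card (?t i j))"
    unfolding chain_le_def ran using dom by auto
  show ?thesis
  proof
    assume "chain_le T S"
    then show "\<forall>a k. arc (col S 0) (col S 1) a k \<longrightarrow> arc (col T 0) (col T 1) a k"
      using arcs_mono_if_card_mono[OF two_column_ballot[OF S] two_column_ballot[OF T]]
      unfolding chain by blast
  next
    assume "\<forall>a k. arc (col S 0) (col S 1) a k \<longrightarrow> arc (col T 0) (col T 1) a k"
    then have "?s i j \<subseteq> ?t i j" for i j by (auto simp: arcs_within_def)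
    then show "chain_le T S" unfolding chain by (blast intro: card_mono[OF finite_arcs_within])
  qed
qed

lemma tableau_word_ascents:
  assumes "two_column {1..n} T"
  shows "tableau_word T \<in> permutations_of_set {1..n}"
    "a \<in> {1..n} \<Longrightarrow> c \<in> {1..n} \<Longrightarrow> a < c \<Longrightarrow>
      position (tableau_word T) a < position (tableau_word T) c \<longleftrightarrow> ascent (col T 0) (col T 1) a c"
proof -
  have "tableau_word T = word_aux n T"
    using card_dom_two_column[OF assms] by (simp add: tableau_word_def)
  then show "tableau_word T \<in> permutations_of_set {1..n}"
    "a \<in> {1..n} \<Longrightarrow> c \<in> {1..n} \<Longrightarrow> a < c \<Longrightarrow>
      position (tableau_word T) a < position (tableau_word T) c \<longleftrightarrow> ascent (col T 0) (col T 1) a c"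
    using word_aux_ascents[OF assms, of n] by (auto intro: permutations_of_setI)
qed

lemma position_inj:
  assumes "distinct w" "a \<in> set w" "c \<in> set w" "position w a = position w c"
  shows "a = c"
  using assms position_nth[OF assms(1)] by (metis in_set_conv_nth)

text \<open>Distinct letters have distinct positions, so inversions and ascents are complementary
  and the inclusion is reversed.\<close>

lemma right_weak_le_iff_ascents:
  assumes T: "two_column {1..n} T" and S: "two_column {1..n} S"
  shows "right_weak_le n (tableau_word T) (tableau_word S) \<longleftrightarrow>
    (\<forall>a c. ascent (col S 0) (col S 1) a c \<longrightarrow> ascent (col T 0) (col T 1) a c)"
proof -
  have inv: "position (tableau_word U) c < position (tableau_word U) a \<longleftrightarrow>
      \<not> ascent (col U 0) (col U 1) a c"
    if U: "two_column {1..n} U" and ac: "1 \<le> a" "a < c" "c \<le> n" for U a c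
  proof -
    have "distinct (tableau_word U)" "set (tableau_word U) = {1..n}"
      using tableau_word_ascents(1)[OF U] by (auto dest: permutations_of_setD)
    then have "position (tableau_word U) a \<noteq> position (tableau_word U) c"
      using position_inj[of "tableau_word U" a c] ac by auto
    then show ?thesis using tableau_word_ascents(2)[OF U, of a c] ac by auto
  qed
  have range: "1 \<le> a \<and> a < c \<and> c \<le> n" if "ascent (col S 0) (col S 1) a c" for a c
    using that two_column_cols(1)[OF S] by (fastforce simp: ascent_def)
  have "right_weak_le n (tableau_word T) (tableau_word S) \<longleftrightarrow>
    (\<forall>a c. 1 \<le> a \<and> a < c \<and> c \<le> n \<longrightarrow>
      ascent (col S 0) (col S 1) a c \<longrightarrow> ascent (col T 0) (col T 1) a c)"
    unfolding right_weak_le_def using tableau_word_ascents(1)[OF T] tableau_word_ascents(1)[OF S]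
      inv[OF T] inv[OF S] by blast
  then show ?thesis using range by blast
qed

text \<open>This matches the strict parts of the two orders. Equal words are comparable both ways,
  so the arcs coincide, and each entry of a second column ends an arc.\<close>

lemma tableau_word_inj:
  assumes T: "two_column {1..n} T" and S: "two_column {1..n} S"
    and eq: "tableau_word T = tableau_word S"
  shows "T = S"
proof -
  have sub: "col U 1 \<subseteq> col V 1" if U: "two_column {1..n} U" and V: "two_column {1..n} V"
    and "tableau_word U = tableau_word V" for U V
  proof
    fix k assume "k \<in> col U 1"
    then obtain a where a: "arc (col U 0) (col U 1) a k"
      using ballot_close_matched[OF two_column_ballot[OF U]] by blast
    have "right_weak_le n (tableau_word V) (tableau_word U)"
      unfolding right_weak_le_def using tableau_word_ascents(1)[OF V] that(3) by simp
    then have "arc (col V 0) (col V 1) a k"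
      using right_weak_le_iff_ascents[OF V U] a
        arcs_mono_if_ascents_mono[OF two_column_ballot[OF U] two_column_ballot[OF V]] by blast
    then show "k \<in> col V 1" using arcD(4) two_column_cols(2)[OF V] by blast
  qed
  then have "col T 1 = col S 1" using sub[OF T S eq] sub[OF S T eq[symmetric]] by blast
  then show ?thesis by (rule two_column_eqI[OF T S])
qed

theorem theorem3p5:
  fixes n :: nat and T S :: tableau
  assumes "n \<ge> 1"
    and "T \<in> two_column_tableaux n"
    and "S \<in> two_column_tableaux n"
  shows "chain_less T S \<longleftrightarrow> right_weak_less n (tableau_word T) (tableau_word S)"
proof -
  have T: "two_column {1..n} T" and S: "two_column {1..n} S"
    using assms two_column_tableaux_iff by auto
  note ballots = two_column_ballot[OF S] two_column_ballot[OF T]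
  have "chain_le T S \<longleftrightarrow> right_weak_le n (tableau_word T) (tableau_word S)"
    unfolding chain_le_iff_arcs[OF T S] right_weak_le_iff_ascents[OF T S]
    using ascents_mono_if_arcs_mono[OF ballots] arcs_mono_if_ascents_mono[OF ballots] by blast
  then show ?thesis
    unfolding chain_less_def right_weak_less_def using tableau_word_inj[OF T S] by blast
qed

end
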